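(* For each completely metrizable and separable topological space $Z$, there is a continuum $X$ such that $NB(F_{1}(X))$ (with the topology induced by the Hausdorff metric) is homeomorphic to $Z$.
   Context: A continuum is a nonempty, non-degenerate (i.e. having more than one point), compact connected metric space. A subcontinuum of a continuum $X$ is a nonempty closed connected subspace of $X$; in particular one-point sets are subcontinua. For a continuum $X$, let $2^{X}=\{A\subset X : A \text{ is a nonempty closed subset of } X\}$, equipped with the Hausdorff metric, and let $F_{1}(X)=\{\{x\} : x\in X\}$ be the hyperspace of singletons. Given a continuum $X$, a nonempty proper closed subset $B$ of $X$ does not block a point $p\in X\setminus B$ if the union of all subcontinua of $X$ that contain $p$ and are contained in $X\setminus B$ is a dense subset of $X$. $NB(F_{1}(X))$ denotes the collection of all nonempty proper closed subsets $B$ of $X$ such that for each $z\in X\setminus B$, $B$ does not block $z$. It is regarded as a subspace of $2^{X}$. *)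

theory Defs
  imports "HOL-Analysis.Analysis"
begin

text \<open>
  Continua are represented as values of type \<^typ>\<open>'a metric\<close>, with an arbitrary carrier and metric.
  Where the existence of a continuum is asserted, the ambient type \<^typ>\<open>nat \<Rightarrow> real\<close> of points
  is used. This costs no generality: for a dense sequence \<open>c\<close> in a compact metric
  space, the map sending \<open>x\<close> to \<open>\<lambda>n. d x (c n)\<close> is injective, so along it the metric can be
  transported, giving an isometric copy of the space with carrier of type \<^typ>\<open>(nat \<Rightarrow> real) set\<close>.
  The metric on that carrier need not be related to the type class metric on \<^typ>\<open>nat \<Rightarrow> real\<close>.
\<close>

definition continuum :: "'a metric \<Rightarrow> bool" where
  "continuum X \<longleftrightarrow>
     compact_space (mtopology_of X) \<and> connected_space (mtopology_of X) \<and>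
     (\<exists>x\<in>mspace X. \<exists>y\<in>mspace X. x \<noteq> y)"

definition subcontinuum :: "'a metric \<Rightarrow> 'a set \<Rightarrow> bool" where
  "subcontinuum X C \<longleftrightarrow>
     C \<noteq> {} \<and> closedin (mtopology_of X) C \<and> connectedin (mtopology_of X) C"

definition nonempty_closed :: "'a metric \<Rightarrow> 'a set set" where
  "nonempty_closed X = {A. A \<noteq> {} \<and> closedin (mtopology_of X) A}"

text \<open>The value \<open>0\<close> outside of \<open>2\<^sup>X\<close> only serves to meet the demand of the locale
  \<^locale>\<open>Metric_space\<close> that a metric be total, nonnegative and symmetric also off the carrier.\<close>

definition hausdorff_dist :: "'a metric \<Rightarrow> 'a set \<Rightarrow> 'a set \<Rightarrow> real" where
  "hausdorff_dist X A B =
     (if A \<in> nonempty_closed X \<and> B \<in> nonempty_closed X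
      then Inf {e. 0 < e \<and> A \<subseteq> (\<Union>b\<in>B. mball_of X b e) \<and> B \<subseteq> (\<Union>a\<in>A. mball_of X a e)}
      else 0)"

text \<open>The hyperspace \<open>2\<^sup>X\<close>; a metric space for compact \<open>X\<close> by \<open>Metric_space_hausdorff\<close> below.\<close>

definition hyperspace :: "'a metric \<Rightarrow> 'a set metric" where
  "hyperspace X = metric (nonempty_closed X, hausdorff_dist X)"

definition does_not_block :: "'a metric \<Rightarrow> 'a set \<Rightarrow> 'a \<Rightarrow> bool" where
  "does_not_block X B p \<longleftrightarrow>
     mtopology_of X closure_of (\<Union>{C. subcontinuum X C \<and> p \<in> C \<and> C \<subseteq> mspace X - B}) = mspace X"

definition NB_F1 :: "'a metric \<Rightarrow> 'a set set" where
  "NB_F1 X = {B \<in> nonempty_closed X. B \<noteq> mspace X \<and> (\<forall>z\<in>mspace X - B. does_not_block X B z)}"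

definition NB_F1_topology :: "'a metric \<Rightarrow> 'a set topology" where
  "NB_F1_topology X = subtopology (mtopology_of (hyperspace X)) (NB_F1 X)"

lemma Metric_space_hausdorff:
  assumes "compact_space (mtopology_of X)"
  shows "Metric_space (nonempty_closed X) (hausdorff_dist X)"
proof -
  define S where "S A B = {e. 0 < e \<and> A \<subseteq> (\<Union>b\<in>B. mball_of X b e) \<and> B \<subseteq> (\<Union>a\<in>A. mball_of X a e)}"
    for A B
  let ?C = "nonempty_closed X"
  let ?h = "hausdorff_dist X"
  have h: "?h A B = Inf (S A B)" if "A \<in> ?C" "B \<in> ?C" for A B
    using that by (simp add: hausdorff_dist_def S_def)
  have sub: "A \<subseteq> mspace X" "A \<noteq> {}" if "A \<in> ?C" for A
    using that closedin_subset[of "mtopology_of X" A] by (auto simp: nonempty_closed_def)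
  interpret M: Metric_space "mspace X" "mdist X" by simp
  have T: "mtopology_of X = M.mtopology"
    by (simp only: mtopology_of_def)
  have "compactin M.mtopology (mspace X)"
    using assms unfolding compact_space_def T M.topspace_mtopology .
  then have "M.mbounded (mspace X)"
    by (rule M.compactin_imp_mbounded)
  then obtain K where K: "\<And>x y. x \<in> mspace X \<Longrightarrow> y \<in> mspace X \<Longrightarrow> mdist X x y \<le> K"
    by (auto simp: M.mbounded_alt)
  have ne: "S A B \<noteq> {}" if AB: "A \<in> ?C" "B \<in> ?C" for A B
  proof -
    have lt: "mdist X x y < \<bar>K\<bar> + 1" if "x \<in> mspace X" "y \<in> mspace X" for x y
      using K[OF that] by linarith
    obtain a b where ab: "a \<in> A" "b \<in> B"
      using sub(2)[OF AB(1)] sub(2)[OF AB(2)] by blast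
    have "x \<in> mball_of X y (\<bar>K\<bar> + 1)" if "x \<in> A \<union> B" "y \<in> A \<union> B" for x y
      unfolding in_mball_of using that sub(1)[OF AB(1)] sub(1)[OF AB(2)] lt by blast
    with ab have "\<bar>K\<bar> + 1 \<in> S A B"
      unfolding S_def by (intro CollectI conjI subsetI) (linarith, blast+)
    then show ?thesis by blast
  qed
  have bdd: "bdd_below (S A B)" for A B
    by (rule bdd_belowI[of _ 0]) (auto simp: S_def)
  have nn: "0 \<le> Inf (S A B)" if "A \<in> ?C" "B \<in> ?C" for A B
    by (rule cInf_greatest[OF ne[OF that]]) (auto simp: S_def)
  have comm: "S A B = S B A" for A B
    by (auto simp: S_def)
  have close: "\<exists>e. e \<in> S A B \<and> e < r" if "A \<in> ?C" "B \<in> ?C" "Inf (S A B) < r" for A B r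
    using cInf_lessD[OF ne[OF that(1,2)] that(3)] by blast
  have zsub: "A \<subseteq> B" if AB: "A \<in> ?C" "B \<in> ?C" and z: "Inf (S A B) = 0" for A B
  proof
    fix x assume x: "x \<in> A"
    have "\<exists>y\<in>B. y \<in> M.mball x r" if r: "0 < r" for r
    proof -
      obtain e where e: "e \<in> S A B" "e < r" using close[OF AB, of r] z r by auto
      then obtain b where b: "b \<in> B" "x \<in> mball_of X b e" using x unfolding S_def by blast
      then have "b \<in> M.mball x r" using e by (simp add: M.in_mball mdist_commute)
      with b show ?thesis by blast
    qed
    moreover have "x \<in> mspace X" using x sub(1)[OF AB(1)] by blast
    ultimately have "x \<in> M.mtopology closure_of B"
      unfolding M.metric_closure_of by blast
    moreover have "M.mtopology closure_of B = B"
      using AB(2) by (simp add: nonempty_closed_def T closure_of_closedin)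
    ultimately show "x \<in> B" by simp
  qed
  have Scomp: "e + f \<in> S A C" if "e \<in> S A B" "f \<in> S B C" for A B C e f
  proof -
    have *: "P \<subseteq> (\<Union>b\<in>R. mball_of X b (u + v))"
      if PQR: "P \<subseteq> (\<Union>b\<in>Q. mball_of X b u)" "Q \<subseteq> (\<Union>b\<in>R. mball_of X b v)" for P Q R u v
    proof
      fix x assume "x \<in> P"
      then obtain y where y: "y \<in> Q" "x \<in> mball_of X y u" using PQR by blast
      then obtain w where w: "w \<in> R" "y \<in> mball_of X w v" using PQR by blast
      have "mdist X w x \<le> mdist X w y + mdist X y x"
        using y w by (intro mdist_triangle) auto
      then show "x \<in> (\<Union>b\<in>R. mball_of X b (u + v))" using y w by (intro UN_I[of w]) auto
    qed
    from that have e: "0 < e" "A \<subseteq> (\<Union>b\<in>B. mball_of X b e)" "B \<subseteq> (\<Union>a\<in>A. mball_of X a e)"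
      and f: "0 < f" "B \<subseteq> (\<Union>b\<in>C. mball_of X b f)" "C \<subseteq> (\<Union>b\<in>B. mball_of X b f)"
      unfolding S_def by blast+
    show ?thesis
      using e(1) f(1) *[OF e(2) f(2)] *[OF f(3) e(3)] unfolding S_def by (simp add: add.commute)
  qed
  show ?thesis
  proof
    show "0 \<le> ?h A B" for A B
      using nn by (simp add: h hausdorff_dist_def S_def)
    show "?h A B = ?h B A" for A B
      by (cases "A \<in> ?C \<and> B \<in> ?C") (simp add: h comm[of A B], auto simp: hausdorff_dist_def)
    show "?h A B = 0 \<longleftrightarrow> A = B" if AB: "A \<in> ?C" "B \<in> ?C" for A B
    proof
      assume "?h A B = 0"
      then show "A = B" using zsub[OF AB] zsub[OF AB(2,1)] h[OF AB] comm[of A B] by auto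
    next
      assume eq: "A = B"
      have "Inf (S A A) \<le> e" if "0 < e" for e
      proof (rule cInf_lower[OF _ bdd])
        show "e \<in> S A A" using that sub(1)[OF AB(1)] by (fastforce simp: S_def)
      qed
      then have "Inf (S A A) \<le> 0" by (rule field_le_epsilon) simp
      then show "?h A B = 0" using nn[OF AB] h[OF AB] eq by simp
    qed
    show "?h A C \<le> ?h A B + ?h B C" if ABC: "A \<in> ?C" "B \<in> ?C" "C \<in> ?C" for A B C
    proof (rule field_le_epsilon)
      fix r :: real assume r: "0 < r"
      obtain e where e: "e \<in> S A B" "e < Inf (S A B) + r/2" using close[OF ABC(1,2)] r by force
      obtain f where f: "f \<in> S B C" "f < Inf (S B C) + r/2" using close[OF ABC(2,3)] r by force
      have "Inf (S A C) \<le> e + f" by (rule cInf_lower[OF Scomp[OF e(1) f(1)] bdd])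
      then show "?h A C \<le> ?h A B + ?h B C + r" using e f ABC by (simp add: h)
    qed
  qed
qed

lemma
  assumes "compact_space (mtopology_of X)"
  shows mspace_hyperspace: "mspace (hyperspace X) = nonempty_closed X"
    and mdist_hyperspace: "mdist (hyperspace X) = hausdorff_dist X"
  unfolding hyperspace_def
  by (simp_all add: Metric_space.mspace_metric Metric_space.mdist_metric
      Metric_space_hausdorff[OF assms])

end

theory Submission
  imports Defs
begin

text \<open>
  The continuum that realises a Polish space \<open>Z\<close> is a Hilbert cube \<open>Q\<close> with countably many pieces
  attached to it. The pieces are arranged so that a set \<open>B\<close> which blocks no point must be a single
  point of \<open>Q\<close>, and so that the points of \<open>Q\<close> that occur form a copy of \<open>Z\<close>. Since the Hausdorff
  distance between singletons is the distance between their points, \<open>NB(F\<^sub>1(X))\<close> is then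
  homeomorphic to \<open>Z\<close>.

  Call a product of closed subintervals of \<open>[0,1]\<close> a brick. For each pair \<open>(U, V)\<close> of bricks
  from a countable list, \<open>X\<close> contains a chain: a sequence of indecomposable continua (the links),
  indexed by the integers, in which consecutive links share one point. Above \<open>Q\<close>, the chain follows
  a path in \<open>Q\<close>, at a height that tends to \<open>0\<close> towards both ends; one end of the path accumulates
  exactly at the points of \<open>U\<close>, the other exactly at those of \<open>V\<close>. Three facts determine the
  nonblocking sets \<open>B\<close>.

  \<^item> \<open>B\<close> meets no chain (\<open>NB_misses_chains\<close>). If \<open>B\<close> meets a link, then, the link being
    indecomposable, a dense set of points of the link can leave it only along continua that contain
    all of it. These continua meet \<open>B\<close>, so such points are blocked.

  \<^item> \<open>B\<close> misses \<open>U\<close> or \<open>V\<close> (\<open>NB_misses_an_end\<close>). A continuum that leaves the chain runs through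
    one of its two ends, and being closed it contains \<open>U\<close> or \<open>V\<close>. Thus, if \<open>B\<close> meets both, then
    no continuum in the complement of \<open>B\<close> leads out of the chain.

  \<^item> A point \<open>k\<close> of \<open>Q\<close> which lies in \<open>U \<inter> V\<close> for no pair of the list blocks no point
    (\<open>point_nonblocking\<close>): each chain still leads down to \<open>Q\<close> at one of its ends, and \<open>Q\<close> without
    \<open>k\<close> is connected by segments.

  If any two points of \<open>Q\<close> are separated by a pair of disjoint bricks from the list, the second fact
  leaves only singletons. A pair \<open>(G, G)\<close> removes exactly the points of \<open>G\<close>. It remains to find a
  copy of \<open>Z\<close> in \<open>Q\<close> whose complement is a countable union of bricks
  (\<open>polish_space_brick_complement\<close>). The map \<open>x \<mapsto> (d(x, c\<^sub>n))\<^sub>n\<close> provides it, where \<open>d\<close> is a complete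
  metric bounded by \<open>1\<close> and \<open>c\<close> is a dense sequence. By completeness, a vector \<open>y\<close> in \<open>Q\<close> is in the
  image as soon as it satisfies the triangle inequalities with the distances \<open>d(c\<^sub>j, c\<^sub>k)\<close> and has
  entries arbitrarily close to \<open>0\<close>; each violation of these conditions is witnessed by a brick, and
  countably many bricks suffice.
\<close>

section \<open>Chains of indecomposable continua\<close>

text \<open>
  On every interval \<open>[m, m+1]\<close> between consecutive integers this is the map with three linear laps,
  each of them onto \<open>[m, m+1]\<close>. The inverse limit of such a three-lap map is an indecomposable
  continuum of Knaster type.
\<close>

definition zigzag :: "real \<Rightarrow> real" where
  "zigzag t = of_int \<lfloor>t\<rfloor> + max (min (3 * frac t) (2 - 3 * frac t)) (3 * frac t - 2)"

text \<open>
  The formula also holds at the right end point \<open>m + 1\<close>, where the floor jumps.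
\<close>

lemma zigzag_eq:
  assumes "of_int m \<le> t" "t \<le> of_int m + 1"
  shows "zigzag t = of_int m + max (min (3 * (t - of_int m)) (2 - 3 * (t - of_int m))) (3 * (t - of_int m) - 2)"
proof (cases "t = of_int m + 1")
  case True
  then show ?thesis by (simp add: zigzag_def frac_def)
next
  case False
  then have "\<lfloor>t\<rfloor> = m" using assms by linarith
  then show ?thesis by (simp add: zigzag_def frac_def)
qed

lemma zigzag_between:
  assumes "of_int m \<le> t" "t \<le> of_int m + 1"
  shows "of_int m \<le> zigzag t" "zigzag t \<le> of_int m + 1"
  using assms by (auto simp: zigzag_eq[OF assms])

lemma zigzag_of_int [simp]: "zigzag (of_int m) = of_int m"
  by (simp add: zigzag_def)

lemma zigzag_laps:
  assumes "of_int m \<le> y" "y \<le> of_int m + 1"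
  shows "zigzag (of_int m + (y - of_int m) / 3) = y"
    and "zigzag (of_int m + 2 / 3 - (y - of_int m) / 3) = y"
    and "zigzag (of_int m + 2 / 3 + (y - of_int m) / 3) = y"
  using assms by (subst zigzag_eq[of m]; auto simp: field_simps)+

lemma zigzag_lipschitz: "\<bar>zigzag s - zigzag t\<bar> \<le> 3 * \<bar>s - t\<bar>"
proof -
  have near: "\<bar>zigzag s - zigzag t\<bar> \<le> 3 * \<bar>s - t\<bar>"
    if "of_int m \<le> s" "s \<le> of_int m + 1" "of_int m \<le> t" "t \<le> of_int m + 1" for m s t
    unfolding zigzag_eq[OF that(1,2)] zigzag_eq[OF that(3,4)]
    by (auto simp: max_def min_def abs_if)
  have le: "\<bar>zigzag s - zigzag t\<bar> \<le> 3 * \<bar>s - t\<bar>" if "s \<le> t" for s t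
  proof (cases "\<lfloor>s\<rfloor> = \<lfloor>t\<rfloor>")
    case True
    show ?thesis by (rule near[of "\<lfloor>s\<rfloor>"]) (use True in linarith)+
  next
    case False
    define p where "p = \<lfloor>s\<rfloor> + 1"
    define q where "q = \<lfloor>t\<rfloor>"
    have "p \<le> q" using False floor_mono[OF that] by (simp add: p_def q_def)
    then have pq: "(of_int p :: real) \<le> of_int q" by simp
    have 1: "s \<le> of_int p" "of_int p \<le> s + 1" unfolding p_def by linarith+
    have 2: "of_int q \<le> t" "t \<le> of_int q + 1" unfolding q_def by linarith+
    have "\<bar>zigzag s - zigzag (of_int p)\<bar> \<le> 3 * \<bar>s - of_int p\<bar>"
      by (rule near[of "p - 1"]) (use 1 in auto)
    moreover have "\<bar>zigzag (of_int q) - zigzag t\<bar> \<le> 3 * \<bar>of_int q - t\<bar>"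
      by (rule near[of q]) (use 2 in auto)
    ultimately show ?thesis using pq 1 2 by simp
  qed
  show ?thesis using le[of s t] le[of t s] by (cases "s \<le> t") (auto simp: abs_minus_commute)
qed

lemma continuous_zigzag [continuous_intros]:
  assumes "continuous_on A f"
  shows "continuous_on A (\<lambda>x. zigzag (f x))"
proof -
  have "continuous_on UNIV zigzag"
    unfolding continuous_on_iff dist_real_def
  proof (intro ballI allI impI)
    fix x e :: real assume "e > 0"
    then show "\<exists>d>0. \<forall>x'\<in>UNIV. \<bar>x' - x\<bar> < d \<longrightarrow> \<bar>zigzag x' - zigzag x\<bar> < e"
      using zigzag_lipschitz[of _ x]
      by (intro exI[of _ "e/3"]) (auto intro: le_less_trans[OF zigzag_lipschitz])
  qed
  then show ?thesis using assms continuous_on_compose2 by blast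
qed

text \<open>
  The inverse limit of \<open>zigzag\<close>. It is the union of its links, the inverse limits over the single
  intervals \<open>[m, m+1]\<close>; consecutive links share the constant sequence at an integer.
\<close>

definition chain :: "(nat \<Rightarrow> real) set" where
  "chain = {x. \<forall>i. zigzag (x (Suc i)) = x i}"

definition link :: "int \<Rightarrow> (nat \<Rightarrow> real) set" where
  "link m = {x \<in> chain. \<forall>i. of_int m \<le> x i \<and> x i \<le> of_int m + 1}"

lemma link_subset_chain: "link m \<subseteq> chain"
  by (auto simp: link_def)

lemma chain_between:
  assumes "x \<in> chain" "of_int m \<le> x j" "x j \<le> of_int m + 1" "i \<le> j"
  shows "of_int m \<le> x i \<and> x i \<le> of_int m + 1"
  using assms(4,2,3)
proof (induction rule: inc_induct)
  case base
  then show ?case by simp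
next
  case (step n)
  then have "zigzag (x (Suc n)) = x n" using assms(1) by (simp add: chain_def)
  then show ?case using step zigzag_between[of m "x (Suc n)"] by auto
qed

lemma chain_agree_below:
  assumes "x \<in> chain" "y \<in> chain" "x j = y j" "i \<le> j"
  shows "x i = y i"
  using assms(4)
proof (induction rule: inc_induct)
  case base
  then show ?case by (fact assms(3))
next
  case (step n)
  have "zigzag (x (Suc n)) = x n" "zigzag (y (Suc n)) = y n"
    using assms(1,2) by (simp_all add: chain_def)
  then show ?case using step.IH by simp
qed

text \<open>
  Any two coordinates of \<open>x\<close> lie in a common interval between consecutive integers, and a coordinate
  strictly inside such an interval leaves no choice.
\<close>

lemma chain_in_link:
  assumes x: "x \<in> chain" and j: "of_int m < x j" "x j < of_int m + 1"
  shows "x \<in> link m"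
proof -
  have "of_int m \<le> x i \<and> x i \<le> of_int m + 1" for i
  proof (cases "i \<le> j")
    case True
    then show ?thesis using chain_between[OF x, of m j i] j by auto
  next
    case False
    have "of_int \<lfloor>x i\<rfloor> \<le> x j \<and> x j \<le> of_int \<lfloor>x i\<rfloor> + 1"
      by (rule chain_between[OF x, of _ i]) (use False in linarith)+
    then have "\<lfloor>x i\<rfloor> = m" using j by linarith
    then show ?thesis by linarith
  qed
  then show ?thesis using x by (simp add: link_def)
qed

lemma chain_eq_Union_links: "chain = (\<Union>m. link m)"
proof
  show "chain \<subseteq> (\<Union>m. link m)"
  proof
    fix x assume x: "x \<in> chain"
    show "x \<in> (\<Union>m. link m)"
    proof (cases "\<forall>j. x j \<in> \<int>")
      case True
      then obtain m where m: "x 0 = of_int m" by (metis Ints_cases)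
      have "x i = of_int m" for i
      proof (induction i)
        case (Suc i)
        obtain k where "x (Suc i) = of_int k" using True by (metis Ints_cases)
        moreover have "zigzag (x (Suc i)) = x i" using x by (simp add: chain_def)
        ultimately show ?case using Suc by simp
      qed (fact m)
      then have "x \<in> link m" using x by (simp add: link_def)
      then show ?thesis by blast
    next
      case False
      then obtain j where "x j \<notin> \<int>" by blast
      then have "of_int \<lfloor>x j\<rfloor> < x j" "x j < of_int \<lfloor>x j\<rfloor> + 1"
        using floor_correct[of "x j"] by (auto simp: order_le_less)
      then show ?thesis using chain_in_link[OF x] by blast
    qed
  qed
qed (auto simp: link_def)

lemma chain_close:
  assumes "x \<in> chain" shows "\<bar>x i - x j\<bar> \<le> 1"
proof -
  obtain m where "x \<in> link m" using assms chain_eq_Union_links by blast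
  then have "of_int m \<le> x i \<and> x i \<le> of_int m + 1" "of_int m \<le> x j \<and> x j \<le> of_int m + 1"
    by (auto simp: link_def)
  then show ?thesis by linarith
qed

text \<open>
  The element of the chain with value \<open>t\<close> at coordinate \<open>N\<close> for which the later coordinates are
  chosen by \<open>h\<close>, a right inverse of \<open>zigzag\<close> on the interval of the link. Taking for \<open>h\<close> the inverse of different laps yields
  points of the link with different behaviour in the limit.
\<close>

definition thread :: "(real \<Rightarrow> real) \<Rightarrow> nat \<Rightarrow> real \<Rightarrow> nat \<Rightarrow> real" where
  "thread h N t i = (if i \<le> N then (zigzag ^^ (N - i)) t else (h ^^ (i - N)) t)"

lemma thread_at [simp]: "thread h N t N = t"
  by (simp add: thread_def)

lemma thread_in_link:
  assumes h: "\<And>s. of_int m \<le> s \<Longrightarrow> s \<le> of_int m + 1 \<Longrightarrow>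
      of_int m \<le> h s \<and> h s \<le> of_int m + 1 \<and> zigzag (h s) = s"
    and t: "of_int m \<le> t" "t \<le> of_int m + 1"
  shows "thread h N t \<in> link m"
proof -
  have zz: "of_int m \<le> (zigzag ^^ k) t \<and> (zigzag ^^ k) t \<le> of_int m + 1" for k
    by (induction k) (use t zigzag_between in auto)
  have hh: "of_int m \<le> (h ^^ k) t \<and> (h ^^ k) t \<le> of_int m + 1" for k
    by (induction k) (use t h in auto)
  have "zigzag (thread h N t (Suc i)) = thread h N t i" for i
  proof (cases "Suc i \<le> N")
    case True
    then have "N - i = Suc (N - Suc i)" by simp
    then show ?thesis using True by (simp add: thread_def)
  next
    case False
    then have "thread h N t i = (h ^^ (i - N)) t"
      by (cases "i = N") (auto simp: thread_def)
    moreover have "thread h N t (Suc i) = h ((h ^^ (i - N)) t)"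
      using False by (simp add: thread_def Suc_diff_le)
    ultimately show ?thesis using h hh by simp
  qed
  then show ?thesis using zz hh by (simp add: link_def chain_def thread_def)
qed

lemma tendsto_fun_iff:
  fixes f :: "'a \<Rightarrow> 'b \<Rightarrow> 'c::topological_space"
  shows "(f \<longlongrightarrow> l) F \<longleftrightarrow> (\<forall>i. ((\<lambda>n. f n i) \<longlongrightarrow> l i) F)"
  using limitin_componentwise[of "\<lambda>_. euclidean" UNIV f l F]
  by (simp add: euclidean_product_topology)

lemma agree_initially_tendsto:
  fixes f :: "nat \<Rightarrow> nat \<Rightarrow> 'c::topological_space"
  assumes "\<And>N i. i \<le> N \<Longrightarrow> f N i = l i"
  shows "f \<longlonglongrightarrow> l"
  unfolding tendsto_fun_iff
proof
  fix i
  have "eventually (\<lambda>N. f N i = l i) sequentially"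
    using eventually_ge_at_top[of i] by eventually_elim (simp add: assms)
  then show "(\<lambda>N. f N i) \<longlonglongrightarrow> l i" by (rule tendsto_eventually)
qed

lemma thread_tendsto:
  assumes "x \<in> chain" "\<And>N. thread h N (x N) \<in> chain"
  shows "(\<lambda>N. thread h N (x N)) \<longlonglongrightarrow> x"
  by (rule agree_initially_tendsto) (metis assms chain_agree_below thread_at)

text \<open>
  The elements of the link that eventually follow the first lap are a union of arcs, all of them
  through the constant sequence \<open>m\<close>. This union is dense in the link.
\<close>

lemma connected_link: "connected (link m)"
proof -
  define h where "h s = of_int m + (s - of_int m) / 3" for s :: real
  have h: "of_int m \<le> h s \<and> h s \<le> of_int m + 1 \<and> zigzag (h s) = s"
    if "of_int m \<le> s" "s \<le> of_int m + 1" for s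
    unfolding h_def using that zigzag_laps[OF that] by auto
  have zz: "continuous_on UNIV ((zigzag ^^ k))" for k
    by (induction k) (auto intro!: continuous_intros simp: o_def)
  have hh: "continuous_on UNIV ((h ^^ k))" for k
    by (induction k) (auto intro!: continuous_intros simp: o_def h_def)
  have cont: "continuous_on UNIV (thread h N)" for N
  proof (rule continuous_on_coordinatewise_then_product)
    show "continuous_on UNIV (\<lambda>t. thread h N t i)" for i
      using zz hh by (cases "i \<le> N") (simp_all add: thread_def)
  qed
  let ?A = "\<Union>N. thread h N ` {of_int m .. of_int m + 1}"
  have joint: "thread h N (of_int m) = (\<lambda>_. of_int m)" for N
  proof -
    have "(zigzag ^^ k) (of_int m) = of_int m" "(h ^^ k) (of_int m) = of_int m" for k
      by (induction k) (auto simp: h_def)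
    then show ?thesis by (auto simp: thread_def)
  qed
  have conn: "connected ?A"
  proof (rule connected_Union)
    fix S assume "S \<in> range (\<lambda>N. thread h N ` {of_int m .. of_int m + 1})"
    then show "connected S"
      by (auto intro!: connected_continuous_image continuous_on_subset[OF cont])
  next
    have "(\<lambda>_. of_int m) \<in> \<Inter> (range (\<lambda>N. thread h N ` {of_int m .. of_int m + 1}))"
      using joint by (auto simp: image_iff intro!: bexI[of _ "of_int m"])
    then show "\<Inter> (range (\<lambda>N. thread h N ` {of_int m .. of_int m + 1})) \<noteq> {}" by blast
  qed
  show ?thesis
  proof (rule connected_intermediate_closure[OF conn])
    show "?A \<subseteq> link m" using thread_in_link[OF h] by auto
    show "link m \<subseteq> closure ?A"
    proof
      fix x assume x: "x \<in> link m"
      then have xN: "of_int m \<le> x N \<and> x N \<le> of_int m + 1" for N by (simp add: link_def)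
      have T: "thread h N (x N) \<in> ?A \<inter> chain" for N
        using thread_in_link[OF h] xN[of N] link_subset_chain by (intro IntI UN_I[of N]) auto
      have "x \<in> chain" using x by (simp add: link_def)
      then have "(\<lambda>N. thread h N (x N)) \<longlonglongrightarrow> x"
        by (rule thread_tendsto) (rule IntD2[OF T])
      moreover have "\<forall>N. thread h N (x N) \<in> ?A" using T by simp
      ultimately show "x \<in> closure ?A"
        unfolding closure_sequential by (intro exI[of _ "\<lambda>N. thread h N (x N)"]) simp
    qed
  qed
qed

text \<open>
  Elements that eventually stay in the middle third are dense in the link. They are the points
  which a set that meets the link will block: on both sides of such a coordinate, there is a lap on
  which \<open>zigzag\<close> takes any given value.
\<close>

lemma middle_thread:
  assumes x: "x \<in> link m"
  obtains z where "z \<in> link m" "z N = x N" "\<And>i. N < i \<Longrightarrow> of_int m + 1/3 \<le> z i \<and> z i \<le> of_int m + 2/3"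
proof
  define h where "h s = of_int m + 2/3 - (s - of_int m) / 3" for s :: real
  have h: "of_int m \<le> h s \<and> h s \<le> of_int m + 1 \<and> zigzag (h s) = s"
    if "of_int m \<le> s" "s \<le> of_int m + 1" for s
  proof (intro conjI)
    show "zigzag (h s) = s" unfolding h_def by (rule zigzag_laps(2)[OF that])
  qed (use that in \<open>simp_all add: h_def field_simps\<close>)
  have xN: "of_int m \<le> x N" "x N \<le> of_int m + 1" using x by (auto simp: link_def)
  show z: "thread h N (x N) \<in> link m" by (rule thread_in_link[OF h xN])
  show "thread h N (x N) N = x N" by simp
  show "of_int m + 1/3 \<le> thread h N (x N) i \<and> thread h N (x N) i \<le> of_int m + 2/3" if "N < i" for i
  proof -
    obtain k where k: "i - N = Suc k" using \<open>N < i\<close> by (cases "i - N") auto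
    have "of_int m \<le> (h ^^ k) (x N) \<and> (h ^^ k) (x N) \<le> of_int m + 1" for k
      by (induction k) (use xN h in auto)
    from this[of k] show ?thesis using that k by (auto simp: thread_def h_def)
  qed
qed

lemma joint_in_link: "(\<lambda>_. of_int m) \<in> link m" "(\<lambda>_. of_int m) \<in> link (m - 1)"
  by (auto simp: link_def chain_def)

lemma closed_coordinate_between:
  fixes f :: "'a::topological_space \<Rightarrow> real"
  assumes "continuous_on UNIV f"
  shows "closed {x. a \<le> f x \<and> f x \<le> b}"
  by (intro closed_Collect_conj closed_Collect_le continuous_on_const assms)

lemma compact_box_fun: "compact {x::nat \<Rightarrow> real. \<forall>i. a i \<le> x i \<and> x i \<le> b i}"
proof -
  have "compactin (product_topology (\<lambda>_. euclidean) (UNIV :: nat set)) (PiE UNIV (\<lambda>i. {a i..b i}))"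
    by (subst compactin_PiE) auto
  moreover have "PiE UNIV (\<lambda>i. {a i..b i}) = {x::nat \<Rightarrow> real. \<forall>i. a i \<le> x i \<and> x i \<le> b i}"
    by (auto simp: PiE_def)
  ultimately show ?thesis by (simp add: euclidean_product_topology)
qed

lemma closed_chain: "closed chain"
proof -
  have "closed {x::nat \<Rightarrow> real. zigzag (x (Suc i)) = x i}" for i
    by (intro closed_Collect_eq continuous_intros continuous_on_product_coordinates)
  then show ?thesis unfolding chain_def by (rule closed_Collect_all)
qed

lemma compact_chain_segment: "compact {x \<in> chain. s \<le> x j \<and> x j \<le> t}"
proof -
  have "{x \<in> chain. s \<le> x j \<and> x j \<le> t}
      = {x. \<forall>i. s - 1 \<le> x i \<and> x i \<le> t + 1} \<inter> (chain \<inter> {x. s \<le> x j \<and> x j \<le> t})"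
    (is "?L = ?R")
  proof
    show "?L \<subseteq> ?R"
    proof
      fix x assume x: "x \<in> ?L"
      then have "\<bar>x i - x j\<bar> \<le> 1" for i using chain_close by auto
      then have "s - 1 \<le> x i \<and> x i \<le> t + 1" for i using x by (smt (verit) mem_Collect_eq)
      then show "x \<in> ?R" using x by auto
    qed
  qed auto
  moreover have "closed {x::nat \<Rightarrow> real. s \<le> x j \<and> x j \<le> t}"
    by (intro closed_coordinate_between continuous_on_product_coordinates)
  ultimately show ?thesis
    using closed_chain by (simp add: compact_Int_closed[OF compact_box_fun] closed_Int)
qed

section \<open>Nonblocking sets of a compact subset of a metric type\<close>

text \<open>
  For \<open>Y = X - B\<close> with \<open>X\<close> compact, the set of all \<open>q\<close> with \<open>joined Y p q\<close> is the union of the subcontinua that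
  contain \<open>p\<close> and avoid \<open>B\<close>.
\<close>

definition joined :: "'a::topological_space set \<Rightarrow> 'a \<Rightarrow> 'a \<Rightarrow> bool" where
  "joined Y p q \<longleftrightarrow> (\<exists>C\<subseteq>Y. compact C \<and> connected C \<and> p \<in> C \<and> q \<in> C)"

lemma joinedI: "compact C \<Longrightarrow> connected C \<Longrightarrow> C \<subseteq> Y \<Longrightarrow> p \<in> C \<Longrightarrow> q \<in> C \<Longrightarrow> joined Y p q"
  by (auto simp: joined_def)

lemma joined_sym: "joined Y p q \<Longrightarrow> joined Y q p"
  by (auto simp: joined_def)

lemma joined_trans:
  assumes "joined Y p q" "joined Y q r" shows "joined Y p r"
proof -
  obtain C D where "C \<subseteq> Y" "compact C" "connected C" "p \<in> C" "q \<in> C"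
    and "D \<subseteq> Y" "compact D" "connected D" "q \<in> D" "r \<in> D"
    using assms by (auto simp: joined_def)
  then show ?thesis
    by (intro joinedI[of "C \<union> D"]) (auto intro: connected_Un)
qed

lemma connected_if_joined:
  assumes "\<And>p q. p \<in> Y \<Longrightarrow> q \<in> Y \<Longrightarrow> joined Y p q"
  shows "connected Y"
proof -
  have "connected_component Y p q" if "p \<in> Y" "q \<in> Y" for p q
    using assms[OF that] unfolding joined_def connected_component_def by blast
  then show ?thesis by (simp add: connected_iff_connected_component)
qed

abbreviation submetric_space :: "'a::metric_space set \<Rightarrow> 'a metric" where
  "submetric_space X \<equiv> submetric euclidean_metric X"

lemma mtopology_of_submetric_space: "mtopology_of (submetric_space X) = top_of_set X"
  by (simp add: mtopology_of_submetric)

lemma nonempty_closed_submetric_space: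
  assumes "closed X"
  shows "nonempty_closed (submetric_space X) = {A. A \<noteq> {} \<and> closed A \<and> A \<subseteq> X}"
  using assms by (auto simp: nonempty_closed_def mtopology_of_submetric_space closedin_closed_eq)

lemma does_not_block_submetric_space:
  assumes X: "compact X" and B: "B \<subseteq> X"
  shows "does_not_block (submetric_space X) B p \<longleftrightarrow> X \<subseteq> closure {q. joined (X - B) p q}"
proof -
  have cl: "closed X" using X by (rule compact_imp_closed)
  have "subcontinuum (submetric_space X) C \<longleftrightarrow> C \<noteq> {} \<and> C \<subseteq> X \<and> compact C \<and> connected C" for C
    using cl compact_Int_closed[OF X, of C]
    by (auto simp: subcontinuum_def mtopology_of_submetric_space closedin_closed_eq
        connectedin_subtopology compact_imp_closed Int_absorb1)
  then have U: "\<Union>{C. subcontinuum (submetric_space X) C \<and> p \<in> C \<and> C \<subseteq> mspace (submetric_space X) - B}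
      = {q. joined (X - B) p q}" (is "?U = ?J")
    unfolding joined_def by (auto 0 3)
  have sub: "?J \<subseteq> X" by (auto simp: joined_def)
  have "mtopology_of (submetric_space X) closure_of ?J = X \<inter> closure ?J"
    using sub by (simp add: mtopology_of_submetric_space closure_of_subtopology Int_absorb1)
  then show ?thesis
    unfolding does_not_block_def U by auto
qed

lemma NB_F1_submetric_space:
  assumes X: "compact X"
  shows "NB_F1 (submetric_space X) =
    {B. B \<noteq> {} \<and> closed B \<and> B \<subset> X \<and> (\<forall>z\<in>X - B. X \<subseteq> closure {q. joined (X - B) z q})}"
  using does_not_block_submetric_space[OF X]
  by (auto simp: NB_F1_def nonempty_closed_submetric_space[OF compact_imp_closed[OF X]])

lemma continuum_submetric_space:
  assumes "compact X" "connected X" "a \<in> X" "b \<in> X" "a \<noteq> b"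
  shows "continuum (submetric_space X)"
  using assms
  by (auto simp: continuum_def mtopology_of_submetric_space compact_space_subtopology
      connected_space_subtopology)

lemma hausdorff_dist_singletons:
  assumes X: "compact X" and ab: "a \<in> X" "b \<in> X"
  shows "hausdorff_dist (submetric_space X) {a} {b} = dist a b"
proof -
  have "{a} \<in> nonempty_closed (submetric_space X)" "{b} \<in> nonempty_closed (submetric_space X)"
    using ab by (auto simp: nonempty_closed_submetric_space[OF compact_imp_closed[OF X]])
  moreover have "{e. 0 < e \<and> {a} \<subseteq> (\<Union>b\<in>{b}. mball_of (submetric_space X) b e)
        \<and> {b} \<subseteq> (\<Union>a\<in>{a}. mball_of (submetric_space X) a e)} = {dist a b<..}"
    using ab by (auto simp: dist_commute intro: le_less_trans[OF zero_le_dist])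
  ultimately show ?thesis by (simp add: hausdorff_dist_def)
qed

text \<open>
  The map \<open>a \<mapsto> {a}\<close> is an isometric embedding of \<open>X\<close> into its hyperspace.
\<close>

lemma singletons_homeomorphic:
  assumes X: "compact X" and A: "A \<subseteq> X"
  shows "subtopology (mtopology_of (hyperspace (submetric_space X))) ((\<lambda>a. {a}) ` A)
    homeomorphic_space top_of_set A"
proof -
  let ?M = "submetric_space X"
  let ?H = "submetric (hyperspace ?M) ((\<lambda>a. {a}) ` A)"
  have comp: "compact_space (mtopology_of ?M)"
    using X by (simp add: mtopology_of_submetric_space compact_space_subtopology)
  have mem: "{a} \<in> mspace (hyperspace ?M)" if "a \<in> A" for a
    using that A by (auto simp: mspace_hyperspace[OF comp] nonempty_closed_submetric_space[OF compact_imp_closed[OF X]])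
  have d: "mdist (hyperspace ?M) {a} {b} = dist a b" if "a \<in> A" "b \<in> A" for a b
    using that A hausdorff_dist_singletons[OF X, of a b] by (auto simp: mdist_hyperspace[OF comp])
  have sp: "mspace ?H = (\<lambda>a. {a}) ` A" using mem by auto
  have 1: "continuous_map (mtopology_of ?H) (mtopology_of (submetric_space A)) the_elem"
    by (rule Lipschitz_continuous_imp_continuous_map)
      (auto simp: Lipschitz_continuous_map_def sp d intro!: exI[of _ 1])
  have 2: "continuous_map (mtopology_of (submetric_space A)) (mtopology_of ?H) (\<lambda>a. {a})"
    by (rule Lipschitz_continuous_imp_continuous_map)
      (auto simp: Lipschitz_continuous_map_def mem d intro!: exI[of _ 1])
  have "homeomorphic_maps (mtopology_of ?H) (mtopology_of (submetric_space A)) the_elem (\<lambda>a. {a})"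
    unfolding homeomorphic_maps_def using 1 2 by (auto simp: sp)
  then show ?thesis
    unfolding mtopology_of_submetric by (auto simp: homeomorphic_space_def)
qed

section \<open>The cube with chains attached\<close>

definition cube :: "(nat \<Rightarrow> real) set" where
  "cube = {x. \<forall>i. 0 \<le> x i \<and> x i \<le> 1}"

text \<open>
  Even coordinates carry a position in the Hilbert cube, odd coordinates a point of a chain; in this way
  the product of both spaces fits into the type of sequences.
\<close>

definition interleave :: "(nat \<Rightarrow> real) \<Rightarrow> (nat \<Rightarrow> real) \<Rightarrow> nat \<Rightarrow> real" where
  "interleave a b j = (if even j then a (j div 2) else b (j div 2))"

definition evens :: "(nat \<Rightarrow> real) \<Rightarrow> nat \<Rightarrow> real" where
  "evens f i = f (2 * i)"

definition odds :: "(nat \<Rightarrow> real) \<Rightarrow> nat \<Rightarrow> real" where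
  "odds f i = f (Suc (2 * i))"

lemma evens_interleave [simp]: "evens (interleave a b) = a"
  and odds_interleave [simp]: "odds (interleave a b) = b"
  by (simp_all add: evens_def odds_def interleave_def fun_eq_iff)

lemma all_nat_parity: "(\<forall>j. P j) \<longleftrightarrow> (\<forall>i. P (2 * i) \<and> P (Suc (2 * i)))" for P :: "nat \<Rightarrow> bool"
  by (metis evenE oddE Suc_eq_plus1)

lemma eq_iff_evens_odds: "f = g \<longleftrightarrow> evens f = evens g \<and> odds f = odds g"
  unfolding fun_eq_iff all_nat_parity[of "\<lambda>j. f j = g j"] by (auto simp: evens_def odds_def)

lemma continuous_odds: "continuous_on UNIV (\<lambda>f. odds f i)"
  unfolding odds_def by (rule continuous_on_product_coordinates)

lemma continuous_evens: "continuous_on A evens"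
  unfolding evens_def
  by (intro continuous_on_coordinatewise_then_product continuous_on_subset[OF continuous_on_product_coordinates]) simp

text \<open>
  The height of the \<open>n\<close>-th chain above the cube at parameter \<open>t\<close>. It tends to \<open>0\<close> towards both
  ends of the chain and as \<open>n\<close> grows, fast enough for its product with \<open>t\<close> to tend to \<open>0\<close> as well.
\<close>

definition height :: "nat \<Rightarrow> real \<Rightarrow> real" where
  "height n t = 1 / ((real n + 1) * (1 + t\<^sup>2))"

definition base :: "(nat \<Rightarrow> real) \<Rightarrow> nat \<Rightarrow> real" where
  "base k = interleave k (\<lambda>_. 0)"

lemma height_pos: "0 < height n t"
  by (simp add: height_def add_pos_nonneg)

lemma height_small:
  assumes "real N \<le> real n \<or> real N + 1 \<le> \<bar>t\<bar>"
  shows "height n t * (\<bar>t\<bar> + 1) \<le> 2 / (real N + 1)"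
proof -
  have *: "\<bar>t\<bar> + 1 \<le> 2 * (1 + t\<^sup>2)" "\<bar>t\<bar> * (\<bar>t\<bar> + 1) \<le> 2 * (1 + t\<^sup>2)"
  proof -
    have "0 \<le> (\<bar>t\<bar> - 1)\<^sup>2" by simp
    then have "2 * \<bar>t\<bar> \<le> 1 + t\<^sup>2" by (simp add: power2_diff)
    moreover have "\<bar>t\<bar> * \<bar>t\<bar> = t\<^sup>2" by (simp add: power2_eq_square)
    ultimately show "\<bar>t\<bar> + 1 \<le> 2 * (1 + t\<^sup>2)" "\<bar>t\<bar> * (\<bar>t\<bar> + 1) \<le> 2 * (1 + t\<^sup>2)"
      using zero_le_power2[of t] by (simp_all only: distrib_left mult_1_right)
  qed
  have pos: "0 < 1 + t\<^sup>2" by (simp add: add_pos_nonneg)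
  have "(\<bar>t\<bar> + 1) * (real N + 1) \<le> 2 * ((real n + 1) * (1 + t\<^sup>2))"
  proof (cases "N \<le> n")
    case True
    then show ?thesis using mult_mono[OF *(1), of "real N + 1" "real n + 1"] by (simp add: algebra_simps)
  next
    case False
    then have "(\<bar>t\<bar> + 1) * (real N + 1) \<le> (\<bar>t\<bar> + 1) * \<bar>t\<bar>" using assms by (intro mult_left_mono) auto
    also have "\<dots> \<le> 1 * (2 * (1 + t\<^sup>2))" using *(2) by (simp add: mult.commute)
    also have "\<dots> \<le> (real n + 1) * (2 * (1 + t\<^sup>2))" by (intro mult_right_mono) auto
    finally show ?thesis by (simp add: algebra_simps)
  qed
  moreover have "0 < (real n + 1) * (1 + t\<^sup>2)" using pos by (intro mult_pos_pos) auto
  ultimately show ?thesis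
    unfolding height_def by (simp only: frac_le_eq pos_divide_le_eq pos_le_divide_eq times_divide_eq_left mult_1_left of_nat_0_less_iff add_nonneg_pos of_nat_0_le_iff zero_less_one)
qed

lemma base_coords [simp]: "evens (base k) = k" "odds (base k) = (\<lambda>_. 0)"
  by (simp_all add: base_def)

lemma continuous_base: "continuous_on A base"
proof (rule continuous_on_coordinatewise_then_product)
  fix j show "continuous_on A (\<lambda>k. base k j)"
    by (cases "even j")
      (auto simp: base_def interleave_def intro: continuous_on_subset[OF continuous_on_product_coordinates])
qed

lemma inj_base: "inj base"
  by (metis base_coords(1) injI)

text \<open>
  For each \<open>n\<close>, the path \<open>F n\<close> enters \<open>E n (-1)\<close> on the negative side and \<open>E n 1\<close> on the positive
  side, and remains there; by \<open>F_dense\<close> and closedness, these sets are exactly its limit sets at the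
  two ends. The sign \<open>\<sigma>\<close> allows both ends to be treated at once.
\<close>

locale chained_cube =
  fixes F :: "nat \<Rightarrow> real \<Rightarrow> nat \<Rightarrow> real" and E :: "nat \<Rightarrow> int \<Rightarrow> (nat \<Rightarrow> real) set"
  assumes continuous_F: "continuous_on UNIV (F n)"
    and F_cube: "F n t \<in> cube"
    and F_end: "\<sigma> \<in> {-1, 1} \<Longrightarrow> 1 \<le> of_int \<sigma> * t \<Longrightarrow> F n t \<in> E n \<sigma>"
    and closed_E: "\<sigma> \<in> {-1, 1} \<Longrightarrow> closed (E n \<sigma>)"
    and F_dense: "\<sigma> \<in> {-1, 1} \<Longrightarrow> u \<in> E n \<sigma> \<Longrightarrow> open V \<Longrightarrow> u \<in> V \<Longrightarrow> \<exists>t. T \<le> of_int \<sigma> * t \<and> F n t \<in> V"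
begin

text \<open>
  The first odd coordinate records the height \<open>h\<close>, the others \<open>h * x j\<close>. Multiplication by \<open>h\<close>
  lets a chain converge to the bottom of the space as its parameter \<open>x 0\<close> becomes large, while \<open>x\<close>
  can be recovered by division.
\<close>

definition emb :: "nat \<Rightarrow> (nat \<Rightarrow> real) \<Rightarrow> nat \<Rightarrow> real" where
  "emb n x = interleave (F n (x 0)) (\<lambda>i. height n (x 0) * case_nat 1 x i)"

definition X :: "(nat \<Rightarrow> real) set" where
  "X = base ` cube \<union> (\<Union>n. emb n ` chain)"

lemma emb_coords [simp]:
  "evens (emb n x) = F n (x 0)" "odds (emb n x) 0 = height n (x 0)"
  "odds (emb n x) (Suc j) = height n (x 0) * x j"
  by (simp_all add: emb_def)

lemma emb_odd_bound:
  assumes "x \<in> chain" "real N \<le> real n \<or> real N + 1 \<le> \<bar>x 0\<bar>"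
  shows "\<bar>odds (emb n x) i\<bar> \<le> 2 / (real N + 1)"
proof -
  have "\<bar>case_nat 1 x i\<bar> \<le> \<bar>x 0\<bar> + 1"
    using chain_close[OF assms(1), of "i - 1" 0] by (cases i) auto
  then have "height n (x 0) * \<bar>case_nat 1 x i\<bar> \<le> height n (x 0) * (\<bar>x 0\<bar> + 1)"
    using height_pos[of n "x 0"] by (intro mult_left_mono) auto
  moreover have "\<bar>odds (emb n x) i\<bar> = height n (x 0) * \<bar>case_nat 1 x i\<bar>"
    using height_pos[of n "x 0"] by (simp add: emb_def abs_mult)
  ultimately show ?thesis using height_small[OF assms(2)] by linarith
qed

lemma continuous_emb: "continuous_on A (emb n)"
proof (rule continuous_on_coordinatewise_then_product)
  fix j
  have c: "continuous_on A (\<lambda>x::nat \<Rightarrow> real. x i)" for i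
    by (rule continuous_on_subset[OF continuous_on_product_coordinates]) simp
  have F: "continuous_on A (\<lambda>x::nat \<Rightarrow> real. F n (x 0) i)" for i
    by (rule continuous_on_compose2[OF continuous_on_product_then_coordinatewise[OF continuous_F] c]) simp
  have nz: "(1 + (x 0)\<^sup>2) \<noteq> (0::real)" for x :: "nat \<Rightarrow> real"
    by (metis add_pos_nonneg less_irrefl zero_le_power2 zero_less_one)
  have h: "continuous_on A (\<lambda>x. height n (x 0))"
    unfolding height_def by (intro continuous_intros c) (use nz in auto)
  have "continuous_on A (\<lambda>x::nat \<Rightarrow> real. case_nat 1 x i)" for i
    by (cases i) (auto intro: c)
  then show "continuous_on A (\<lambda>x. emb n x j)"
    using F h by (cases "even j") (auto simp: emb_def interleave_def intro!: continuous_on_mult)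
qed

lemma emb_not_base: "emb n x \<noteq> base k"
  by (metis base_coords(2) emb_coords(2) height_pos less_irrefl)

lemma compact_sector: "compact (emb n ` {x \<in> chain. s \<le> x j \<and> x j \<le> t})"
  by (intro compact_continuous_image continuous_emb compact_chain_segment)

text \<open>
  The relation \<open>h\<^sup>2 + (h * x 0)\<^sup>2 = h / (n + 1)\<close> shows that the first two odd coordinates determine
  the index \<open>n\<close> of the chain.
\<close>

lemma emb_sum_squares:
  "(odds (emb n x) 0)\<^sup>2 + (odds (emb n x) (Suc 0))\<^sup>2 = odds (emb n x) 0 / (real n + 1)"
proof -
  have "height n (x 0) * (1 + (x 0)\<^sup>2) = 1 / (real n + 1)"
    using add_pos_nonneg[OF zero_less_one zero_le_power2, of "x 0"] by (simp add: height_def)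
  then have "height n (x 0) * (height n (x 0) * (1 + (x 0)\<^sup>2)) = height n (x 0) / (real n + 1)"
    by simp
  then show ?thesis
    by (simp add: power2_eq_square algebra_simps)
qed

lemma emb_same_index:
  assumes "emb n x = emb n' x'" shows "n = n'"
proof -
  have h: "height n (x 0) = height n' (x' 0)" using assms emb_coords(2) by metis
  have "height n (x 0) / (real n + 1) = height n' (x' 0) / (real n' + 1)"
    using emb_sum_squares[of n x] emb_sum_squares[of n' x'] unfolding assms emb_coords(2)
    by (metis assms emb_coords(2))
  then show ?thesis unfolding h using height_pos[of n' "x' 0"] by (simp add: field_simps)
qed

text \<open>
  Sectors of a chain that are bounded by two values of one coordinate are cut out of \<open>X\<close> by strict
  inequalities. Together with the compactness of the closed sectors this provides the relatively
  clopen sets by which continua are shown to be confined.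
\<close>

lemma openin_sector: "openin (top_of_set X) (emb n ` {x \<in> chain. s < x j \<and> x j < t})"
proof -
  \<comment> \<open>The last two inequalities express, by the lemma on the sum of squares, that the chain has an
    index strictly between \<open>n - 1/2\<close> and \<open>n + 1/2\<close>.\<close>
  define O' where "O' = {f::nat \<Rightarrow> real. 0 < odds f 0 \<and> s * odds f 0 < odds f (Suc j) \<and> odds f (Suc j) < t * odds f 0
     \<and> odds f 0 / (real n + 3/2) < (odds f 0)\<^sup>2 + (odds f (Suc 0))\<^sup>2
     \<and> (odds f 0)\<^sup>2 + (odds f (Suc 0))\<^sup>2 < odds f 0 / (real n + 1/2)}"
  have "open O'"
    unfolding O'_def
    by (intro open_Collect_conj open_Collect_less continuous_intros continuous_odds) auto
  moreover have "X \<inter> O' = emb n ` {x \<in> chain. s < x j \<and> x j < t}"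
  proof (intro equalityI subsetI)
    fix f assume f: "f \<in> X \<inter> O'"
    then have "0 < odds f 0" by (simp add: O'_def)
    then obtain n' x where x: "f = emb n' x" "x \<in> chain"
      using f base_coords(2) by (auto simp: X_def)
    let ?h = "height n' (x 0)"
    have h: "0 < ?h" by (rule height_pos)
    from f have O: "f \<in> O'" by blast
    have "?h / (real n + 3/2) < ?h / (real n' + 1)" "?h / (real n' + 1) < ?h / (real n + 1/2)"
      using O unfolding O'_def x mem_Collect_eq emb_sum_squares by simp_all
    then have "inverse (real n + 3/2) < inverse (real n' + 1)" "inverse (real n' + 1) < inverse (real n + 1/2)"
      using h unfolding divide_inverse by (blast dest: mult_less_cancel_left_pos[THEN iffD1, rotated])+
    then have "real n' + 1 < real n + 3/2" "real n + 1/2 < real n' + 1"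
      by (auto dest!: inverse_less_imp_less)
    then have "n' = n" by linarith
    moreover have "s < x j" "x j < t"
      using O h unfolding O'_def x mem_Collect_eq emb_coords by (simp_all add: mult.commute)
    ultimately show "f \<in> emb n ` {x \<in> chain. s < x j \<and> x j < t}" using x by blast
  next
    fix f assume "f \<in> emb n ` {x \<in> chain. s < x j \<and> x j < t}"
    then obtain x where x: "f = emb n x" "x \<in> chain" "s < x j" "x j < t" by blast
    have "0 < height n (x 0)" by (rule height_pos)
    then have "f \<in> O'"
      unfolding O'_def x(1) mem_Collect_eq emb_sum_squares using x(3,4)
      by (simp add: mult.commute frac_less2 del: mult_Suc_right)
    then show "f \<in> X \<inter> O'" using x by (auto simp: X_def)
  qed
  ultimately show ?thesis by (metis openin_open)
qed

text \<open>
  Outside the slab of height \<open>2 / (N + 1)\<close> above the cube, \<open>X\<close> consists of compact parts of the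
  first \<open>N\<close> chains. Hence \<open>X\<close> is the intersection of compact sets \<open>Y N\<close>, each of them the union of
  such a slab with finitely many of these parts.
\<close>

lemma compact_X: "compact X"
proof -
  define slab where "slab N = {f::nat \<Rightarrow> real. \<forall>j. (if even j then 0 else - 2 / (real N + 1)) \<le> f j
      \<and> f j \<le> (if even j then 1 else 2 / (real N + 1))}" for N
  have slab: "f \<in> slab N \<longleftrightarrow> evens f \<in> cube \<and> (\<forall>i. \<bar>odds f i\<bar> \<le> 2 / (real N + 1))" for f N
    unfolding slab_def mem_Collect_eq all_nat_parity[of "\<lambda>j. (if even j then 0 else - 2 / (real N + 1)) \<le> f j
      \<and> f j \<le> (if even j then 1 else 2 / (real N + 1))"]
    by (auto simp: cube_def evens_def odds_def abs_le_iff) (metis minus_le_iff)+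
  define Y where "Y N = slab N \<union> (\<Union>n<N. emb n ` {x \<in> chain. - (real N + 1) \<le> x 0 \<and> x 0 \<le> real N + 1})" for N
  have Y: "compact (Y N)" for N
    unfolding Y_def slab_def
    by (intro compact_Un compact_UN compact_box_fun compact_sector finite_lessThan)
  have "X = (\<Inter>N. Y N)"
  proof (intro equalityI subsetI INT_I)
    fix f N assume "f \<in> X"
    then consider k where "k \<in> cube" "f = base k" | n x where "x \<in> chain" "f = emb n x"
      by (auto simp: X_def)
    then show "f \<in> Y N"
    proof cases
      case 1
      then show ?thesis by (simp add: Y_def slab)
    next
      case 2
      show ?thesis
      proof (cases "real N \<le> real n \<or> real N + 1 \<le> \<bar>x 0\<bar>")
        case True
        then show ?thesis using emb_odd_bound[OF 2(1) True] F_cube 2 by (simp add: Y_def slab)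
      next
        case False
        then have "n < N" "- (real N + 1) \<le> x 0" "x 0 \<le> real N + 1" by linarith+
        then show ?thesis using 2 unfolding Y_def by blast
      qed
    qed
  next
    fix f assume f: "f \<in> (\<Inter>N. Y N)"
    show "f \<in> X"
    proof (cases "\<forall>N. f \<in> slab N")
      case True
      have "odds f i = 0" for i
      proof -
        have "\<bar>odds f i\<bar> \<le> 2 / (real N + 1)" for N using True by (simp add: slab)
        moreover have "(\<lambda>N. 2 / (real N + 1)) \<longlonglongrightarrow> 0"
          using LIMSEQ_Suc[OF lim_const_over_n[of 2]] by (simp add: add.commute)
        ultimately have "\<bar>odds f i\<bar> \<le> 0" by (intro LIMSEQ_le_const) auto
        then show ?thesis by simp
      qed
      then have "f = base (evens f)"
        unfolding eq_iff_evens_odds[of f] by (simp add: fun_eq_iff)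
      then show ?thesis using True by (auto simp: slab X_def)
    next
      case False
      then show ?thesis using f by (fastforce simp: Y_def X_def)
    qed
  qed
  moreover have "closed (\<Inter>N. Y N)" using Y compact_imp_closed by (intro closed_INT) auto
  moreover have "(\<Inter>N. Y N) = Y 0 \<inter> (\<Inter>N. Y N)" by blast
  ultimately show ?thesis using compact_Int_closed[OF Y[of 0]] by metis
qed

end

section \<open>Points of the cube that block nothing\<close>

lemma signs_cases: "\<sigma> \<in> {-1, 1} \<Longrightarrow> (\<sigma> = -1 \<Longrightarrow> P) \<Longrightarrow> (\<sigma> = (1::int) \<Longrightarrow> P) \<Longrightarrow> P"
  by auto

lemma connected_half_chain:
  assumes "\<sigma> \<in> {-1, 1}"
  shows "connected (\<Union>k. link (m + \<sigma> * int k))"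
proof -
  let ?S = "\<lambda>N. \<Union>k\<le>N. link (m + \<sigma> * int k)"
  have S: "connected (?S N)" for N
  proof (induction N)
    case 0
    then show ?case by (simp add: connected_link)
  next
    case (Suc N)
    have "link (m + \<sigma> * int N) \<inter> link (m + \<sigma> * int (Suc N)) \<noteq> {}"
      using assms
    proof (rule signs_cases)
      assume "\<sigma> = -1"
      then show ?thesis
        using joint_in_link[of "m - int N"] by (auto simp: algebra_simps)
    next
      assume "\<sigma> = 1"
      then show ?thesis
        using joint_in_link[of "m + int N + 1"] by (auto simp: algebra_simps)
    qed
    then have "?S N \<inter> link (m + \<sigma> * int (Suc N)) \<noteq> {}" by blast
    moreover have "?S (Suc N) = ?S N \<union> link (m + \<sigma> * int (Suc N))" by (auto simp: le_Suc_eq)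
    ultimately show ?case using connected_Un[OF Suc connected_link] by simp
  qed
  have "connected (\<Union> (range ?S))"
  proof (rule connected_Union)
    have "(\<lambda>_. of_int m) \<in> ?S N" for N using joint_in_link(1)[of m] by (auto intro!: bexI[of _ 0])
    then show "\<Inter> (range ?S) \<noteq> {}" by blast
  qed (use S in auto)
  moreover have "\<Union> (range ?S) = (\<Union>k. link (m + \<sigma> * int k))" by auto
  ultimately show ?thesis by simp
qed

definition segment :: "(nat \<Rightarrow> real) \<Rightarrow> (nat \<Rightarrow> real) \<Rightarrow> (nat \<Rightarrow> real) set" where
  "segment a b = (\<lambda>t i. (1 - t) * a i + t * b i) ` {0..1}"

lemma segment_cube:
  assumes "a \<in> cube" "b \<in> cube" shows "segment a b \<subseteq> cube"
proof
  fix x assume "x \<in> segment a b"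
  then obtain t where t: "0 \<le> t" "t \<le> 1" "x = (\<lambda>i. (1 - t) * a i + t * b i)" by (auto simp: segment_def)
  have "0 \<le> x i \<and> x i \<le> 1" for i
  proof -
    have ab: "0 \<le> a i" "a i \<le> 1" "0 \<le> b i" "b i \<le> 1" using assms by (auto simp: cube_def)
    have "(1 - t) * a i + t * b i \<le> (1 - t) * 1 + t * 1"
      using t ab by (intro add_mono mult_left_mono) auto
    moreover have "0 \<le> (1 - t) * a i + t * b i"
      using t ab by (intro add_nonneg_nonneg mult_nonneg_nonneg) auto
    ultimately show ?thesis using t by simp
  qed
  then show "x \<in> cube" by (simp add: cube_def)
qed

lemma segment_joined:
  assumes "a \<in> cube" "b \<in> cube" "k \<notin> segment a b"
  shows "joined (cube - {k}) a b"
proof (rule joinedI)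
  have c: "continuous_on {0..1} (\<lambda>t i. (1 - t) * a i + t * b i)"
    by (intro continuous_on_coordinatewise_then_product continuous_intros)
  show "compact (segment a b)" "connected (segment a b)"
    unfolding segment_def
    by (intro compact_continuous_image connected_continuous_image c; simp)+
  show "segment a b \<subseteq> cube - {k}" using segment_cube assms by auto
  show "a \<in> segment a b" unfolding segment_def by (rule image_eqI[of _ _ 0]) auto
  show "b \<in> segment a b" unfolding segment_def by (rule image_eqI[of _ _ 1]) auto
qed

text \<open>
  If \<open>k\<close> lies on the segment from \<open>a\<close> to \<open>b\<close>, a detour through a point \<open>w\<close> off the line avoids it.
  The points \<open>a\<close> and \<open>w\<close> differ in a single coordinate, in which \<open>w\<close> is an end point of \<open>[0, 1]\<close>.
\<close>

lemma cube_minus_point_joined: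
  assumes a: "a \<in> cube" "a \<noteq> k" and b: "b \<in> cube" "b \<noteq> k"
  shows "joined (cube - {k}) a b"
proof (cases "k \<in> segment a b")
  case False
  then show ?thesis using segment_joined a b by blast
next
  case True
  then obtain t where t: "0 \<le> t" "t \<le> 1" "k = (\<lambda>i. (1 - t) * a i + t * b i)" by (auto simp: segment_def)
  have t1: "t \<noteq> 1" using t b by auto
  obtain i where i: "a i \<noteq> k i" using a by blast
  then have ab: "a i \<noteq> b i" using t by (auto simp: algebra_simps)
  define w where "w = a(Suc i := if a (Suc i) = 0 then 1 else 0)"
  have w: "w \<in> cube" "w (Suc i) \<noteq> a (Suc i)" "w i = a i" using a by (auto simp: w_def cube_def)
  have "k \<notin> segment a w"
  proof
    assume "k \<in> segment a w"
    then have "k i = a i" using w by (auto simp: segment_def algebra_simps)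
    then show False using i by simp
  qed
  moreover have "k \<notin> segment w b"
  proof
    assume "k \<in> segment w b"
    then obtain s where s: "k = (\<lambda>i. (1 - s) * w i + s * b i)" by (auto simp: segment_def)
    have "(1 - s) * a i + s * b i = (1 - t) * a i + t * b i" using s t w by metis
    then have "(s - t) * (b i - a i) = 0" by (simp add: algebra_simps)
    then have "s = t" using ab by simp
    then have "(1 - t) * w (Suc i) + t * b (Suc i) = (1 - t) * a (Suc i) + t * b (Suc i)" using s t by metis
    then show False using t1 w by simp
  qed
  ultimately show ?thesis using segment_joined a b w joined_trans by blast
qed

lemma joined_base:
  assumes "joined Y a b" "base ` Y \<subseteq> Z" shows "joined Z (base a) (base b)"
proof -
  obtain C where "C \<subseteq> Y" "compact C" "connected C" "a \<in> C" "b \<in> C" using assms by (auto simp: joined_def)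
  then show ?thesis
    using assms(2)
    by (intro joinedI[of "base ` C"] compact_continuous_image connected_continuous_image continuous_base) auto
qed

lemma link_at:
  obtains x where "x \<in> link \<lfloor>t\<rfloor>" "x 0 = t"
proof
  define h where "h s = of_int \<lfloor>t\<rfloor> + (s - of_int \<lfloor>t\<rfloor>) / 3" for s :: real
  have h: "of_int \<lfloor>t\<rfloor> \<le> h s \<and> h s \<le> of_int \<lfloor>t\<rfloor> + 1 \<and> zigzag (h s) = s"
    if "of_int \<lfloor>t\<rfloor> \<le> s" "s \<le> of_int \<lfloor>t\<rfloor> + 1" for s
    unfolding h_def using that zigzag_laps[OF that] by auto
  show "thread h 0 t \<in> link \<lfloor>t\<rfloor>" by (rule thread_in_link[OF h]) linarith+
  show "thread h 0 t 0 = t" by simp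
qed

context chained_cube
begin

lemma F_E_self: "\<sigma> \<in> {-1, 1} \<Longrightarrow> F n (of_int \<sigma>) \<in> E n \<sigma>"
  by (rule F_end) auto

text \<open>
  Near an end of a chain, the position is close to a given point \<open>u\<close> of the limit set for suitable
  values \<open>\<tau> N\<close> of the parameter, and it depends on the parameter alone. Thus any choice of chain
  elements with these parameters converges to the point \<open>u\<close> at the bottom.
\<close>

lemma ends_approach:
  assumes \<sigma>: "\<sigma> \<in> {-1, 1}" and u: "u \<in> E n \<sigma>"
  obtains \<tau> where "\<And>N. T + real N \<le> of_int \<sigma> * \<tau> N"
    and "\<And>y. (\<And>N. y N \<in> chain) \<Longrightarrow> (\<And>N. y N 0 = \<tau> N) \<Longrightarrow> (\<lambda>N. emb n (y N)) \<longlonglongrightarrow> base u"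
proof -
  have "\<exists>t. max T 1 + real N \<le> of_int \<sigma> * t \<and> F n t \<in> ball u (inverse (real (Suc N)))" for N
    by (rule F_dense[OF \<sigma> u]) auto
  then obtain \<tau> where \<tau>: "\<And>N. max T 1 + real N \<le> of_int \<sigma> * \<tau> N"
    "\<And>N. F n (\<tau> N) \<in> ball u (inverse (real (Suc N)))" by metis
  show thesis
  proof
    show "T + real N \<le> of_int \<sigma> * \<tau> N" for N using \<tau>(1)[of N] by linarith
    fix y assume y: "\<And>N. y N \<in> chain" "\<And>N. y N 0 = \<tau> N"
    have "(\<lambda>N. F n (\<tau> N)) \<longlonglongrightarrow> u"
    proof (rule metric_tendsto_imp_tendsto[of "\<lambda>N. inverse (real (Suc N))" 0])
      show "\<forall>\<^sub>F N in sequentially. dist (F n (\<tau> N)) u \<le> dist (inverse (real (Suc N))) 0"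
        using \<tau>(2) by (intro always_eventually) (auto simp: dist_commute less_imp_le)
    qed (rule LIMSEQ_inverse_real_of_nat)
    then have ev: "(\<lambda>N. evens (emb n (y N)) i) \<longlonglongrightarrow> u i" for i
      using y unfolding tendsto_fun_iff by simp
    have od: "(\<lambda>N. odds (emb n (y N)) i) \<longlonglongrightarrow> 0" for i
    proof (rule Lim_null_comparison)
      show "\<forall>\<^sub>F N in sequentially. norm (odds (emb n (y N)) i) \<le> 2 / (real N + 1)"
      proof (intro always_eventually allI)
        fix N
        have "\<bar>y N 0\<bar> = \<bar>of_int \<sigma> * \<tau> N\<bar>" using y \<sigma> by (auto simp: abs_mult)
        then have "real N + 1 \<le> \<bar>y N 0\<bar>" using \<tau>(1)[of N] by linarith
        then show "norm (odds (emb n (y N)) i) \<le> 2 / (real N + 1)"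
          using emb_odd_bound[OF y(1)] by simp
      qed
      show "(\<lambda>N. 2 / (real N + 1)) \<longlonglongrightarrow> 0"
        using LIMSEQ_Suc[OF lim_const_over_n[of 2]] by (simp add: add.commute)
    qed
    show "(\<lambda>N. emb n (y N)) \<longlonglongrightarrow> base u"
      unfolding tendsto_fun_iff all_nat_parity[of "\<lambda>j. (\<lambda>N. emb n (y N) j) \<longlonglongrightarrow> base u j"]
      using ev[unfolded evens_def] od[unfolded odds_def] by (simp add: base_def interleave_def)
  qed
qed

lemma base_in_X: "k \<in> cube \<Longrightarrow> base k \<in> X"
  by (simp add: X_def)

lemma emb_in_X: "x \<in> chain \<Longrightarrow> emb n x \<in> X"
  by (auto simp: X_def)

text \<open>
  The closure of the half chain from the given link towards the end \<open>\<sigma>\<close> is a continuum. All the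
  points that it adds at the bottom belong to \<open>E n \<sigma>\<close>, so it avoids \<open>B\<close>.
\<close>

lemma link_joined_base:
  assumes \<sigma>: "\<sigma> \<in> {-1, 1}" and x: "x \<in> link m"
    and B1: "\<And>n. B \<inter> emb n ` chain = {}" and B2: "B \<inter> base ` E n \<sigma> = {}"
  shows "joined (X - B) (emb n x) (base (F n (of_int \<sigma>)))"
proof -
  let ?u = "F n (of_int \<sigma>)"
  let ?H = "\<Union>k. link (m + \<sigma> * int k)"
  let ?C = "closure (emb n ` ?H)"
  have HX: "emb n ` ?H \<subseteq> X" using link_subset_chain by (auto intro!: emb_in_X)
  then have CX: "?C \<subseteq> X" using compact_imp_closed[OF compact_X] closure_minimal by blast
  \<comment> \<open>The part of the half chain where the path has not yet entered \<open>E n \<sigma>\<close> has bounded parameters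
    and therefore stays at height at least \<open>\<delta>\<close>.\<close>
  define \<delta> where "\<delta> = 1 / ((real n + 1) * (1 + (\<bar>of_int m\<bar> + 1)\<^sup>2))"
  have \<delta>: "0 < \<delta>" by (simp add: \<delta>_def add_pos_nonneg)
  have "emb n ` ?H \<subseteq> evens -` E n \<sigma> \<union> {f. \<delta> \<le> odds f 0}"
  proof (intro subsetI)
    fix f assume "f \<in> emb n ` ?H"
    then obtain y k where y: "f = emb n y" "y \<in> link (m + \<sigma> * int k)" by blast
    then have y0: "of_int m + of_int \<sigma> * real k \<le> y 0" "y 0 \<le> of_int m + of_int \<sigma> * real k + 1"
      by (auto simp: link_def)
    show "f \<in> evens -` E n \<sigma> \<union> {f. \<delta> \<le> odds f 0}"
    proof (cases "1 \<le> of_int \<sigma> * y 0")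
      case True
      then show ?thesis using F_end[OF \<sigma>] y by simp
    next
      case False
      then have "of_int m \<le> y 0 \<and> y 0 < 1 \<or> -1 < y 0 \<and> y 0 \<le> of_int m + 1" using y0 \<sigma> by auto
      then have "\<bar>y 0\<bar> \<le> \<bar>of_int m\<bar> + 1" by linarith
      then have "(y 0)\<^sup>2 \<le> (\<bar>of_int m\<bar> + 1)\<^sup>2" using abs_le_square_iff by fastforce
      then have "\<delta> \<le> height n (y 0)"
        unfolding \<delta>_def height_def
        by (intro divide_left_mono mult_left_mono mult_pos_pos) (auto simp: add_pos_nonneg)
      then show ?thesis using y by simp
    qed
  qed
  moreover have "closed (evens -` E n \<sigma> \<union> {f. \<delta> \<le> odds f 0})"
    by (intro closed_Un closed_Collect_le continuous_on_const continuous_odds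
        closed_vimage[OF closed_E[OF \<sigma>] continuous_evens])
  ultimately have C: "?C \<subseteq> evens -` E n \<sigma> \<union> {f. \<delta> \<le> odds f 0}" by (rule closure_minimal)
  have "?C \<inter> B = {}"
  proof (rule ccontr)
    assume "?C \<inter> B \<noteq> {}"
    then obtain f where f: "f \<in> ?C" "f \<in> B" by blast
    then have "f \<in> X" using CX by blast
    then obtain k where k: "f = base k" using f(2) B1 unfolding X_def by blast
    then have "k \<in> E n \<sigma>" using f C \<delta> by auto
    then show False using f k B2 by blast
  qed
  moreover have "base ?u \<in> ?C"
  proof -
    have far: "\<exists>k. \<lfloor>t\<rfloor> = m + \<sigma> * int k" if t: "\<bar>of_int m\<bar> + 1 \<le> of_int \<sigma> * t" for t :: real
      using \<sigma>
    proof (rule signs_cases)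
      assume "\<sigma> = -1"
      then have "\<lfloor>t\<rfloor> \<le> m" using t by simp linarith
      then show ?thesis using \<open>\<sigma> = -1\<close> by (intro exI[of _ "nat (m - \<lfloor>t\<rfloor>)"]) simp
    next
      assume "\<sigma> = 1"
      then have "m \<le> \<lfloor>t\<rfloor>" using t by simp linarith
      then show ?thesis using \<open>\<sigma> = 1\<close> by (intro exI[of _ "nat (\<lfloor>t\<rfloor> - m)"]) simp
    qed
    obtain \<tau> where \<tau>: "\<And>N. \<bar>of_int m\<bar> + 1 + real N \<le> of_int \<sigma> * \<tau> N"
      "\<And>y. (\<And>N. y N \<in> chain) \<Longrightarrow> (\<And>N. y N 0 = \<tau> N) \<Longrightarrow> (\<lambda>N. emb n (y N)) \<longlonglongrightarrow> base ?u"
      using ends_approach[OF \<sigma> F_E_self[OF \<sigma>], of "\<bar>of_int m\<bar> + 1"] by metis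
    have "\<exists>y. y \<in> link \<lfloor>\<tau> N\<rfloor> \<and> y 0 = \<tau> N" for N using link_at by metis
    then obtain y where y: "\<And>N. y N \<in> link \<lfloor>\<tau> N\<rfloor>" "\<And>N. y N 0 = \<tau> N" by metis
    have yH: "y N \<in> ?H" for N
    proof -
      obtain k where "\<lfloor>\<tau> N\<rfloor> = m + \<sigma> * int k" using far[of "\<tau> N"] \<tau>(1)[of N] by auto
      then show ?thesis using y(1)[of N] by auto
    qed
    have "(\<lambda>N. emb n (y N)) \<longlonglongrightarrow> base ?u"
      by (rule \<tau>(2)) (rule subsetD[OF link_subset_chain y(1)], rule y(2))
    then show ?thesis
      unfolding closure_sequential using yH by (intro exI[of _ "\<lambda>N. emb n (y N)"] conjI allI imageI)
  qed
  moreover have "emb n x \<in> ?C"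
    using x by (intro closure_subset[THEN subsetD] imageI) (auto intro!: exI[of _ 0])
  moreover have "compact ?C" using compact_X CX closed_closure by (metis compact_Int_closed inf.absorb_iff2)
  moreover have "connected ?C"
    by (intro connected_imp_connected_closure connected_continuous_image continuous_emb connected_half_chain \<sigma>)
  ultimately show ?thesis using CX by (intro joinedI[of ?C]) auto
qed

lemma all_joined:
  assumes B1: "\<And>n. B \<inter> emb n ` chain = {}"
    and B2: "\<And>n. \<exists>\<sigma>\<in>{-1, 1}. B \<inter> base ` E n \<sigma> = {}"
    and B3: "\<And>a b. a \<in> cube \<Longrightarrow> b \<in> cube \<Longrightarrow> base a \<notin> B \<Longrightarrow> base b \<notin> B \<Longrightarrow> joined (X - B) (base a) (base b)"
    and pq: "p \<in> X - B" "q \<in> X - B"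
  shows "joined (X - B) p q"
proof -
  have *: "\<exists>a\<in>cube. base a \<notin> B \<and> joined (X - B) p (base a)" if p: "p \<in> X - B" for p
  proof (cases "p \<in> base ` cube")
    case True
    then show ?thesis using B3 p by blast
  next
    case False
    then obtain n x where n: "p = emb n x" "x \<in> chain" using p by (auto simp: X_def)
    then obtain m where "x \<in> link m" using chain_eq_Union_links by blast
    note x = n(1) this
    obtain \<sigma> where \<sigma>: "\<sigma> \<in> {-1, 1}" "B \<inter> base ` E n \<sigma> = {}" using B2 by metis
    have "joined (X - B) p (base (F n (of_int \<sigma>)))"
      unfolding x(1) by (rule link_joined_base[OF \<sigma>(1) x(2) B1 \<sigma>(2)])
    moreover have "base (F n (of_int \<sigma>)) \<notin> B" using \<sigma>(2) F_E_self[OF \<sigma>(1)] by blast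
    ultimately show ?thesis using F_cube by blast
  qed
  obtain a b where "a \<in> cube" "base a \<notin> B" "joined (X - B) p (base a)"
    "b \<in> cube" "base b \<notin> B" "joined (X - B) q (base b)" using *[OF pq(1)] *[OF pq(2)] by blast
  then show ?thesis using B3 by (meson joined_sym joined_trans)
qed

lemma connected_X: "connected X"
proof (rule connected_if_joined)
  fix p q assume "p \<in> X" "q \<in> X"
  moreover have "joined X (base a) (base b)" if "a \<in> cube" "b \<in> cube" for a b
  proof -
    \<comment> \<open>a point outside the cube, so that removing it changes nothing\<close>
    define k :: "nat \<Rightarrow> real" where "k = (\<lambda>_. 2)"
    have "k \<notin> cube" by (simp add: k_def cube_def)
    then show ?thesis using that cube_minus_point_joined[of a k b]
      by (intro joined_base[of "cube - {k}"]) (auto intro: base_in_X)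
  qed
  ultimately show "joined X p q" using all_joined[of "{}" p q] by auto
qed

lemma point_nonblocking:
  assumes k: "k \<in> cube" and good: "\<And>n. k \<notin> E n (-1) \<inter> E n 1"
  shows "{base k} \<in> NB_F1 (submetric_space X)"
proof -
  let ?B = "{base k}"
  have j: "joined (X - ?B) p q" if "p \<in> X - ?B" "q \<in> X - ?B" for p q
  proof (rule all_joined[OF _ _ _ that])
    show "?B \<inter> emb n ` chain = {}" for n using emb_not_base[of n] by fastforce
    show "\<exists>\<sigma>\<in>{-1, 1}. ?B \<inter> base ` E n \<sigma> = {}" for n
    proof -
      obtain \<sigma> where "\<sigma> \<in> {-1, 1::int}" "k \<notin> E n \<sigma>" using good[of n] by blast
      then show ?thesis by (intro bexI[of _ \<sigma>]) (auto dest: injD[OF inj_base])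
    qed
    show "joined (X - ?B) (base a) (base b)"
      if "a \<in> cube" "b \<in> cube" "base a \<notin> ?B" "base b \<notin> ?B" for a b
      using that
      by (intro joined_base[OF cube_minus_point_joined[of a k b]])
        (auto intro: base_in_X dest: injD[OF inj_base])
  qed
  have emb0: "emb 0 (\<lambda>_. of_int 0) \<in> X - ?B"
    using emb_in_X joint_in_link(1) link_subset_chain emb_not_base by blast
  have "base k islimpt X"
    by (rule connected_imp_perfect[OF connected_X]) (use emb0 k base_in_X in auto)
  then have "base k \<in> closure (X - ?B)" by (simp add: islimpt_in_closure)
  then have "insert (base k) (X - ?B) \<subseteq> closure (X - ?B)" by (intro insert_subsetI closure_subset)
  then have X: "X \<subseteq> closure (X - ?B)" by (rule order_trans[rotated]) blast
  have "X \<subseteq> closure {q. joined (X - ?B) z q}" if "z \<in> X - ?B" for z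
    using X j[OF that] closure_mono[of "X - ?B" "{q. joined (X - ?B) z q}"] by blast
  then show ?thesis
    unfolding NB_F1_submetric_space[OF compact_X] using emb0 k base_in_X by auto
qed

section \<open>Sets that block\<close>

text \<open>
  A connected set that avoids both boundary values of a coordinate cannot leave the sector between
  them: the sector is then clopen in it.
\<close>

lemma connected_in_sector:
  assumes C: "connected C" "C \<subseteq> X"
    and meets: "emb n z \<in> C" "z \<in> chain" "s < z j" "z j < t"
    and avoids: "\<And>x. x \<in> chain \<Longrightarrow> x j = s \<or> x j = t \<Longrightarrow> emb n x \<notin> C"
  shows "C \<subseteq> emb n ` {x \<in> chain. s < x j \<and> x j < t}" (is "_ \<subseteq> ?O")
proof -
  let ?K = "emb n ` {x \<in> chain. s \<le> x j \<and> x j \<le> t}"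
  have eq: "C \<inter> ?O = C \<inter> ?K" using avoids by (auto simp: order_le_less)
  have "openin (top_of_set C) (C \<inter> ?O)"
  proof -
    obtain T where "open T" "?O = X \<inter> T" using openin_sector[of n s j t] unfolding openin_open by metis
    then have "C \<inter> ?O = C \<inter> T" using C(2) by blast
    then show ?thesis using \<open>open T\<close> openin_open_Int by metis
  qed
  moreover have "closedin (top_of_set C) (C \<inter> ?O)"
    unfolding eq using compact_imp_closed[OF compact_sector] by (rule closedin_closed_Int)
  moreover have "C \<inter> ?O \<noteq> {}" using meets by blast
  ultimately have "C \<inter> ?O = C" using C(1) unfolding connected_clopen by blast
  then show ?thesis by blast
qed

lemma emb_tendsto: "y \<longlonglongrightarrow> x \<Longrightarrow> (\<lambda>N. emb n (y N)) \<longlonglongrightarrow> emb n x"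
  by (rule continuous_on_tendsto_compose[OF continuous_emb[of UNIV]]) auto

lemma not_dense_in_one_chain:
  assumes "A \<subseteq> emb n ` chain" shows "\<not> X \<subseteq> closure A"
proof
  assume d: "X \<subseteq> closure A"
  let ?O = "emb (Suc n) ` {x \<in> chain. -1 < x 0 \<and> x 0 < 1}"
  obtain T where T: "open T" "?O = X \<inter> T" using openin_sector[of "Suc n" "-1" 0 1] by (auto simp: openin_open)
  have "emb (Suc n) (\<lambda>_. of_int 0) \<in> ?O"
    using joint_in_link(1)[of 0] link_subset_chain by (intro imageI) auto
  then have "T \<inter> closure A \<noteq> {}" using d T by blast
  then have "T \<inter> A \<noteq> {}" using open_Int_closure_eq_empty[OF T(1)] by blast
  moreover have "A \<subseteq> X" using assms emb_in_X by blast
  ultimately have "?O \<inter> A \<noteq> {}" using T by blast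
  then show False using assms emb_same_index by fastforce
qed

lemma NB_no_trapped_point:
  assumes B: "B \<in> NB_F1 (submetric_space X)" and z: "z \<in> chain" "emb n z \<notin> B"
    and trapped: "\<And>C. connected C \<Longrightarrow> compact C \<Longrightarrow> C \<subseteq> X - B \<Longrightarrow> emb n z \<in> C \<Longrightarrow> C \<subseteq> emb n ` chain"
  shows False
proof -
  have "emb n z \<in> X - B" using z emb_in_X by blast
  then have "X \<subseteq> closure {q. joined (X - B) (emb n z) q}"
    using B unfolding NB_F1_submetric_space[OF compact_X] by blast
  moreover have "{q. joined (X - B) (emb n z) q} \<subseteq> emb n ` chain"
    using trapped unfolding joined_def by blast
  ultimately show False using not_dense_in_one_chain by blast
qed

text \<open>
  Let \<open>B\<close> meet the link \<open>m\<close> in the image of \<open>y\<close>. Either \<open>B\<close> contains the dense set \<open>D\<close> of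
  elements that eventually stay in the middle third, hence the entire link and so a nonempty
  open set, which is impossible. Or some \<open>z\<close> in \<open>D\<close> is not in \<open>B\<close>. A continuum \<open>C\<close> through \<open>z\<close>
  that avoids \<open>B\<close> also avoids all chain elements that agree with \<open>y\<close> at a late coordinate \<open>j\<close>. At
  coordinate \<open>j + 1\<close>, the first and the third lap take the value \<open>y j\<close> on either side of \<open>z\<close>, and \<open>C\<close> is
  trapped between them.
\<close>

lemma NB_misses_chains:
  assumes B: "B \<in> NB_F1 (submetric_space X)"
  shows "B \<inter> emb n ` chain = {}"
proof (rule ccontr)
  assume "B \<inter> emb n ` chain \<noteq> {}"
  then obtain y where y: "y \<in> chain" "emb n y \<in> B" by blast
  then obtain m where m: "y \<in> link m" using chain_eq_Union_links by blast
  have B': "closed B" "B \<subset> X" "\<And>z. z \<in> X - B \<Longrightarrow> X \<subseteq> closure {q. joined (X - B) z q}"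
    using B unfolding NB_F1_submetric_space[OF compact_X] by auto
  define D where "D = {z \<in> link m. \<exists>N. \<forall>i>N. of_int m + 1/3 \<le> z i \<and> z i \<le> of_int m + 2/3}"
  show False
  proof (cases "emb n ` D \<subseteq> B")
    case True
    have "emb n ` link m \<subseteq> B"
    proof
      fix f assume "f \<in> emb n ` link m"
      then obtain x where x: "f = emb n x" "x \<in> link m" by blast
      have "\<exists>z. z \<in> D \<and> z N = x N" for N
      proof -
        obtain z where "z \<in> link m" "z N = x N"
          "\<And>i. N < i \<Longrightarrow> of_int m + 1/3 \<le> z i \<and> z i \<le> of_int m + 2/3"
          by (rule middle_thread[OF x(2), of N]) (rule that)
        then show ?thesis unfolding D_def by (intro exI[of _ z] conjI CollectI exI[of _ N]) auto
      qed
      then obtain z where z: "\<And>N. z N \<in> D" "\<And>N. z N N = x N" by metis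
      have ch: "x \<in> chain" "\<And>N. z N \<in> chain" using x z by (auto simp: D_def link_def)
      have "z \<longlonglongrightarrow> x"
        by (rule agree_initially_tendsto) (rule chain_agree_below[OF ch(2) ch(1) z(2)])
      then have "(\<lambda>N. emb n (z N)) \<longlonglongrightarrow> emb n x"
        by (rule emb_tendsto)
      then show "f \<in> B" unfolding x(1)
        by (rule closed_sequentially[OF B'(1) subsetD[OF True imageI[OF z(1)]]])
    qed
    moreover have "{x \<in> chain. of_int m < x 0 \<and> x 0 < of_int m + 1} \<subseteq> link m"
      using chain_in_link by blast
    ultimately have O: "emb n ` {x \<in> chain. of_int m < x 0 \<and> x 0 < of_int m + 1} \<subseteq> B" (is "?O \<subseteq> B")
      by blast
    obtain w where w: "w \<in> link m" "w 0 = of_int m + 1/2"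
    proof -
      have "\<lfloor>of_int m + 1/2 :: real\<rfloor> = m" by linarith
      then show thesis using link_at[of "of_int m + 1/2"] that by metis
    qed
    then have wO: "emb n w \<in> ?O" using link_subset_chain by (intro imageI) auto
    obtain T where T: "open T" "?O = X \<inter> T"
      using openin_sector[of n "of_int m" 0 "of_int m + 1"] unfolding openin_open by metis
    obtain z where z: "z \<in> X - B" using B'(2) by blast
    then have "T \<inter> closure {q. joined (X - B) z q} \<noteq> {}" using B'(3) wO T by blast
    then have "T \<inter> {q. joined (X - B) z q} \<noteq> {}" using open_Int_closure_eq_empty[OF T(1)] by blast
    then obtain q where "q \<in> T" "q \<in> X - B" by (auto simp: joined_def)
    then show False using T O by blast
  next
    case False
    then obtain z where z: "z \<in> D" "emb n z \<notin> B" by blast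
    then have zc: "z \<in> chain" by (auto simp: D_def link_def)
    obtain N where N: "\<And>i. i > N \<Longrightarrow> of_int m + 1/3 \<le> z i \<and> z i \<le> of_int m + 2/3"
      using z by (auto simp: D_def)
    show False
    proof (rule NB_no_trapped_point[OF B zc z(2)])
      fix C assume C: "connected C" "compact C" "C \<subseteq> X - B" "emb n z \<in> C"
      have "\<exists>M. \<forall>x\<in>chain. x M = y M \<longrightarrow> emb n x \<notin> C"
      proof (rule ccontr)
        assume "\<not> ?thesis"
        then obtain x where x: "\<And>M. x M \<in> chain" "\<And>M. x M M = y M" "\<And>M. emb n (x M) \<in> C" by metis
        have "x \<longlonglongrightarrow> y"
          by (rule agree_initially_tendsto) (rule chain_agree_below[OF x(1) y(1) x(2)])
        then have "(\<lambda>M. emb n (x M)) \<longlonglongrightarrow> emb n y"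
          by (rule emb_tendsto)
        then have "emb n y \<in> C"
          by (rule closed_sequentially[OF compact_imp_closed[OF C(2)] x(3)])
        then show False using y C by blast
      qed
      then obtain M where M: "\<And>x. x \<in> chain \<Longrightarrow> x M = y M \<Longrightarrow> emb n x \<notin> C" by blast
      define j where "j = max M N"
      \<comment> \<open>the preimages of \<open>y j\<close> on the first and on the third lap\<close>
      define s where "s = of_int m + (y j - of_int m) / 3"
      define t where "t = of_int m + 2/3 + (y j - of_int m) / 3"
      have yj: "of_int m \<le> y j" "y j \<le> of_int m + 1" using m by (auto simp: link_def)
      have avoid: "emb n x \<notin> C" if "x \<in> chain" "x (Suc j) = s \<or> x (Suc j) = t" for x
      proof -
        have "x j = zigzag (x (Suc j))" using that(1) by (simp add: chain_def)
        also have "\<dots> = y j" using that(2) zigzag_laps(1,3)[OF yj] by (auto simp: s_def t_def)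
        finally have "x M = y M" using chain_agree_below[OF that(1) y(1)] by (simp add: j_def)
        then show ?thesis using M that(1) by blast
      qed
      have "N < Suc j" by (simp add: j_def)
      then have zj: "of_int m + 1/3 \<le> z (Suc j)" "z (Suc j) \<le> of_int m + 2/3" using N by blast+
      have "(y j - of_int m) / 3 \<le> 1/3" "0 \<le> (y j - of_int m) / 3" using yj by simp_all
      then have "s \<le> z (Suc j)" "z (Suc j) \<le> t" unfolding s_def t_def using zj by linarith+
      moreover have "z (Suc j) \<noteq> s" "z (Suc j) \<noteq> t" using avoid[OF zc] C(4) by auto
      ultimately have "C \<subseteq> emb n ` {x \<in> chain. s < x (Suc j) \<and> x (Suc j) < t}"
        using C zc avoid by (intro connected_in_sector[of C n z]) auto
      then show "C \<subseteq> emb n ` chain" by blast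
    qed
  qed
qed

text \<open>
  A continuum through the middle of the chain that avoids the points \<open>u\<close> and \<open>v\<close> at the bottom also
  avoids a neighbourhood of each. Near each end of the chain, the path visits this neighbourhood, which
  excludes some parameter value; between the two excluded values the continuum is trapped.
\<close>

lemma NB_misses_an_end:
  assumes B: "B \<in> NB_F1 (submetric_space X)"
    and uv: "base u \<in> B" "u \<in> E n (-1)" "base v \<in> B" "v \<in> E n 1"
  shows False
proof -
  define z :: "nat \<Rightarrow> real" where "z = (\<lambda>_. of_int 0)"
  have z: "z \<in> chain" using joint_in_link(1)[of 0] link_subset_chain by (auto simp: z_def)
  then have zB: "emb n z \<notin> B" using NB_misses_chains[OF B, of n] by blast
  show False
  proof (rule NB_no_trapped_point[OF B z zB])
    fix C assume C: "connected C" "compact C" "C \<subseteq> X - B" "emb n z \<in> C"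
    have gap: "\<exists>t. 1 \<le> of_int \<sigma> * t \<and> (\<forall>x\<in>chain. x 0 = t \<longrightarrow> emb n x \<notin> C)"
      if \<sigma>: "\<sigma> \<in> {-1, 1}" and w: "w \<in> E n \<sigma>" "base w \<in> B" for \<sigma> w
    proof (rule ccontr)
      assume no: "\<not> ?thesis"
      obtain \<tau> where \<tau>: "\<And>N. 1 + real N \<le> of_int \<sigma> * \<tau> N"
        "\<And>y. (\<And>N. y N \<in> chain) \<Longrightarrow> (\<And>N. y N 0 = \<tau> N) \<Longrightarrow> (\<lambda>N. emb n (y N)) \<longlonglongrightarrow> base w"
        using ends_approach[OF \<sigma> w(1), of 1] by metis
      have "\<exists>x\<in>chain. x 0 = \<tau> N \<and> emb n x \<in> C" for N
        using no \<tau>(1)[of N] by (smt (verit) of_nat_0_le_iff)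
      then obtain x where x: "\<And>N. x N \<in> chain" "\<And>N. x N 0 = \<tau> N" "\<And>N. emb n (x N) \<in> C" by metis
      have "base w \<in> C"
        by (rule closed_sequentially[OF compact_imp_closed[OF C(2)] x(3) \<tau>(2)[OF x(1,2)]])
      then show False using w C by blast
    qed
    obtain s where s: "1 \<le> of_int (-1) * s" "\<forall>x\<in>chain. x 0 = s \<longrightarrow> emb n x \<notin> C"
      using gap[of "-1" u] uv by auto
    obtain t where t: "1 \<le> of_int 1 * t" "\<forall>x\<in>chain. x 0 = t \<longrightarrow> emb n x \<notin> C"
      using gap[of 1 v] uv by auto
    have "C \<subseteq> emb n ` {x \<in> chain. s < x 0 \<and> x 0 < t}"
      using C z s t by (intro connected_in_sector[of C n z]) (auto simp: z_def)
    then show "C \<subseteq> emb n ` chain" by blast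
  qed
qed

lemma NB_F1_X:
  assumes separated: "\<And>u v. u \<in> cube \<Longrightarrow> v \<in> cube \<Longrightarrow> u \<noteq> v \<Longrightarrow>
      \<exists>n. u \<in> E n (-1) \<and> v \<in> E n 1 \<or> v \<in> E n (-1) \<and> u \<in> E n 1"
  shows "NB_F1 (submetric_space X) = (\<lambda>a. {a}) ` base ` (cube - (\<Union>n. E n (-1) \<inter> E n 1))"
proof (intro equalityI subsetI)
  fix B assume B: "B \<in> NB_F1 (submetric_space X)"
  then have "B \<noteq> {}" "B \<subseteq> X" unfolding NB_F1_submetric_space[OF compact_X] by auto
  then have sub: "B \<subseteq> base ` cube" using NB_misses_chains[OF B] unfolding X_def by blast
  obtain k where k: "k \<in> cube" "base k \<in> B" using \<open>B \<noteq> {}\<close> sub by blast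
  have "l = k" if "l \<in> cube" "base l \<in> B" for l
    using separated[OF that(1) k(1)] NB_misses_an_end[OF B] k that by blast
  then have "B = {base k}" using sub k by blast
  moreover have "k \<notin> E n (-1) \<inter> E n 1" for n using NB_misses_an_end[OF B] k by blast
  ultimately show "B \<in> (\<lambda>a. {a}) ` base ` (cube - (\<Union>n. E n (-1) \<inter> E n 1))" using k by blast
next
  fix B assume "B \<in> (\<lambda>a. {a}) ` base ` (cube - (\<Union>n. E n (-1) \<inter> E n 1))"
  then show "B \<in> NB_F1 (submetric_space X)" using point_nonblocking by blast
qed

lemma NB_F1_topology_X:
  assumes separated: "\<And>u v. u \<in> cube \<Longrightarrow> v \<in> cube \<Longrightarrow> u \<noteq> v \<Longrightarrow>
      \<exists>n. u \<in> E n (-1) \<and> v \<in> E n 1 \<or> v \<in> E n (-1) \<and> u \<in> E n 1"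
  shows "NB_F1_topology (submetric_space X) homeomorphic_space
    top_of_set (cube - (\<Union>n. E n (-1) \<inter> E n 1))" (is "_ homeomorphic_space top_of_set ?K")
proof -
  have eq: "NB_F1 (submetric_space X) = (\<lambda>a. {a}) ` base ` ?K"
    by (rule NB_F1_X) (rule separated)
  have "NB_F1_topology (submetric_space X) homeomorphic_space top_of_set (base ` ?K)"
    unfolding NB_F1_topology_def eq
    by (rule singletons_homeomorphic[OF compact_X]) (auto intro: base_in_X)
  also have "top_of_set (base ` ?K) homeomorphic_space top_of_set ?K"
  proof -
    have "homeomorphic_maps (top_of_set (base ` ?K)) (top_of_set ?K) evens base"
      unfolding homeomorphic_maps_def
      by (auto simp: continuous_map_in_subtopology continuous_evens continuous_base)
    then show ?thesis by (auto simp: homeomorphic_space_def)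
  qed
  finally show ?thesis .
qed

lemma continuum_X: "continuum (submetric_space X)"
proof (rule continuum_submetric_space[OF compact_X connected_X])
  show "emb 0 (\<lambda>_. of_int 0) \<in> X"
    using joint_in_link(1)[of 0] link_subset_chain by (intro emb_in_X) auto
  show "base (F 0 0) \<in> X" by (intro base_in_X F_cube)
  show "emb 0 (\<lambda>_. of_int 0) \<noteq> base (F 0 0)" by (rule emb_not_base)
qed

end

section \<open>Paths that accumulate on bricks\<close>

text \<open>
  By Tietze's theorem, a sequence that visits each element of a countable dense set infinitely often
  extends, one coordinate at a time, to a path.
\<close>

lemma dense_path_in_cube:
  "\<exists>\<gamma> :: real \<Rightarrow> nat \<Rightarrow> real. continuous_on UNIV \<gamma> \<and> (\<forall>t. \<gamma> t \<in> cube) \<and>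
    (\<forall>u\<in>cube. \<forall>V T. open V \<longrightarrow> u \<in> V \<longrightarrow> (\<exists>t\<ge>T. \<gamma> t \<in> V))"
proof -
  obtain D :: "(nat \<Rightarrow> real) set" where D: "countable D"
    "\<And>V. open V \<Longrightarrow> V \<noteq> {} \<Longrightarrow> \<exists>d\<in>D. d \<in> V"
    using countable_dense_exists by metis
  have "D \<noteq> {}" using D(2)[of UNIV] by auto
  define clamp where "clamp x i = max 0 (min 1 (x i))" for x :: "nat \<Rightarrow> real" and i
  have clamp: "clamp x \<in> cube" for x by (simp add: clamp_def cube_def)
  have clamp_id: "clamp x = x" if "x \<in> cube" for x using that by (auto simp: clamp_def cube_def)
  have clamp_cont: "continuous_on UNIV clamp"
    unfolding clamp_def
    by (intro continuous_on_coordinatewise_then_product continuous_intros continuous_on_product_coordinates)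
  define e where "e m = clamp (from_nat_into D (fst (prod_decode m)))" for m
  have hits: "\<exists>m\<ge>N. e m \<in> V" if V: "u \<in> cube" "open V" "u \<in> V" for u V N
  proof -
    have "open (clamp -` V)" using open_vimage[OF V(2) clamp_cont] .
    moreover have "u \<in> clamp -` V" using clamp_id[OF V(1)] V(3) by simp
    ultimately obtain d where d: "d \<in> D" "clamp d \<in> V" using D(2)[of "clamp -` V"] by auto
    obtain a where "from_nat_into D a = d" using from_nat_into_surj[OF D(1) d(1)] by blast
    then have "e (prod_encode (a, N)) \<in> V" using d by (simp add: e_def)
    then show ?thesis using le_prod_encode_2 by blast
  qed
  have "\<exists>g :: real \<Rightarrow> real. continuous_on UNIV g \<and> (\<forall>x\<in>\<nat>. g x = e (nat \<lfloor>x\<rfloor>) i) \<and> (\<forall>x. g x \<in> cbox 0 (1::real))" for i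
  proof -
    have "continuous_on (\<nat>::real set) (\<lambda>x. e (nat \<lfloor>x\<rfloor>) i)"
      unfolding continuous_on_iff
    proof (intro ballI allI impI)
      fix x \<epsilon> :: real assume "x \<in> \<nat>" "0 < \<epsilon>"
      moreover have "x' = x" if "x' \<in> \<nat>" "dist x' x < 1" for x'
        using that \<open>x \<in> \<nat>\<close> by (auto simp: dist_real_def elim!: Nats_cases)
      ultimately show "\<exists>d>0. \<forall>x'\<in>\<nat>. dist x' x < d \<longrightarrow> dist (e (nat \<lfloor>x'\<rfloor>) i) (e (nat \<lfloor>x\<rfloor>) i) < \<epsilon>"
        by (metis dist_self zero_less_one)
    qed
    then show ?thesis
    proof (rule Tietze_closed_interval_1[of _ _ UNIV 0 1])
      show "e (nat \<lfloor>x\<rfloor>) i \<in> cbox 0 1" for x :: real using clamp by (auto simp: e_def cube_def)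
      fix g :: "real \<Rightarrow> real" assume "continuous_on UNIV g" "\<And>x. x \<in> \<nat> \<Longrightarrow> g x = e (nat \<lfloor>x\<rfloor>) i"
        "\<And>x. x \<in> UNIV \<Longrightarrow> g x \<in> cbox 0 (1::real)"
      then show ?thesis by (intro exI[of _ g] conjI) blast+
    qed auto
  qed
  then obtain g :: "nat \<Rightarrow> real \<Rightarrow> real" where g: "\<And>i. continuous_on UNIV (g i)" "\<And>i x. x \<in> \<nat> \<Longrightarrow> g i x = e (nat \<lfloor>x\<rfloor>) i"
    "\<And>i x. g i x \<in> cbox 0 (1::real)" by metis
  show ?thesis
  proof (intro exI[of _ "\<lambda>t i. g i t"] conjI allI ballI impI)
    show "continuous_on UNIV (\<lambda>t i. g i t)"
      by (intro continuous_on_coordinatewise_then_product g)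
    show "(\<lambda>i. g i t) \<in> cube" for t using g(3) by (auto simp: cube_def)
    show "\<exists>t\<ge>T. (\<lambda>i. g i t) \<in> V" if "u \<in> cube" "open V" "u \<in> V" for u V T
    proof -
      have "\<exists>m\<ge>nat \<lceil>T\<rceil>. e m \<in> V" by (rule hits[OF that])
      then obtain m where m: "m \<ge> nat \<lceil>T\<rceil>" "e m \<in> V" by blast
      have "(\<lambda>i. g i (real m)) = e m" by (simp add: g(2))
      moreover have "T \<le> real m" using m by linarith
      ultimately show ?thesis using m by metis
    qed
  qed
qed

definition brick :: "(nat \<Rightarrow> real) \<Rightarrow> (nat \<Rightarrow> real) \<Rightarrow> (nat \<Rightarrow> real) set" where
  "brick l r = {x. \<forall>i. l i \<le> x i \<and> x i \<le> r i}"

definition bricks :: "(nat \<Rightarrow> real) set set" where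
  "bricks = {brick l r | l r. \<forall>i. 0 \<le> l i \<and> l i \<le> r i \<and> r i \<le> 1}"

lemma bricksI: "(\<And>i. 0 \<le> l i \<and> l i \<le> r i \<and> r i \<le> 1) \<Longrightarrow> brick l r \<in> bricks"
  by (auto simp: bricks_def)

lemma bricks_closed: "U \<in> bricks \<Longrightarrow> closed U"
  using compact_imp_closed[OF compact_box_fun] by (auto simp: bricks_def brick_def)

lemma bricks_subset_cube: "U \<in> bricks \<Longrightarrow> U \<subseteq> cube"
  by (fastforce simp: bricks_def brick_def cube_def intro: order_trans)

lemma cube_in_bricks: "cube \<in> bricks"
proof -
  have "cube = brick (\<lambda>_. 0) (\<lambda>_. 1)" by (auto simp: cube_def brick_def)
  then show ?thesis using bricksI[of "\<lambda>_. 0" "\<lambda>_. 1"] by simp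
qed

text \<open>
  A brick is an affine image of the cube, so the path dense in the cube induces paths dense in \<open>U0\<close>
  and in \<open>U1\<close>. For parameters in \<open>[-1, 1]\<close> the function \<open>s\<close> blends one into the other.
\<close>

lemma path_between_bricks:
  assumes "U0 \<in> bricks" "U1 \<in> bricks"
  shows "\<exists>F :: real \<Rightarrow> nat \<Rightarrow> real. continuous_on UNIV F \<and> (\<forall>t. F t \<in> cube) \<and> (\<forall>t\<le>-1. F t \<in> U0) \<and> (\<forall>t\<ge>1. F t \<in> U1)
    \<and> (\<forall>u\<in>U0. \<forall>V T. open V \<longrightarrow> u \<in> V \<longrightarrow> (\<exists>t. T \<le> - t \<and> F t \<in> V))
    \<and> (\<forall>u\<in>U1. \<forall>V T. open V \<longrightarrow> u \<in> V \<longrightarrow> (\<exists>t. T \<le> t \<and> F t \<in> V))"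
proof -
  from dense_path_in_cube obtain \<gamma> :: "real \<Rightarrow> nat \<Rightarrow> real" where *: "continuous_on UNIV \<gamma> \<and> (\<forall>t. \<gamma> t \<in> cube) \<and>
    (\<forall>u\<in>cube. \<forall>V T. open V \<longrightarrow> u \<in> V \<longrightarrow> (\<exists>t\<ge>T. \<gamma> t \<in> V))" by (rule exE)
  have \<gamma>: "continuous_on UNIV \<gamma>" "\<gamma> t \<in> cube" for t using * by simp_all
  have \<gamma>_dense: "\<exists>t\<ge>T. \<gamma> t \<in> V" if "u \<in> cube" "open V" "u \<in> V" for u V T using * that by simp
  have stretch: "\<exists>A. continuous_on UNIV A \<and> A ` cube = U" if "U \<in> bricks" for U
  proof -
    obtain l r where lr: "U = brick l r" "\<And>i. 0 \<le> l i" "\<And>i. l i \<le> r i" "\<And>i. r i \<le> 1"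
      using \<open>U \<in> bricks\<close> by (auto simp: bricks_def)
    define A where "A c i = l i + (r i - l i) * c i" for c i
    have "A c \<in> U" if "c \<in> cube" for c
    proof -
      have "0 \<le> (r i - l i) * c i \<and> (r i - l i) * c i \<le> (r i - l i) * 1" for i
        using that lr(3)[of i] by (intro conjI mult_nonneg_nonneg mult_left_mono) (auto simp: cube_def)
      then have "l i \<le> A c i \<and> A c i \<le> r i" for i unfolding A_def by (smt (verit))
      then show ?thesis by (simp add: lr(1) brick_def)
    qed
    moreover have "u \<in> A ` cube" if "u \<in> U" for u
    proof (rule image_eqI)
      let ?c = "\<lambda>i. (u i - l i) / (r i - l i)"
      have u: "l i \<le> u i" "u i \<le> r i" for i using that by (auto simp: lr(1) brick_def)
      have "0 \<le> ?c i \<and> ?c i \<le> 1" for i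
        using u[of i] by (cases "r i = l i") (auto simp: divide_le_eq_1)
      then show "?c \<in> cube" by (simp add: cube_def)
      show "u = A ?c"
      proof
        fix i show "u i = A ?c i" using u[of i] by (cases "r i = l i") (auto simp: A_def)
      qed
    qed
    ultimately have "A ` cube = U" by blast
    moreover have "continuous_on UNIV A"
      unfolding A_def
      by (intro continuous_on_coordinatewise_then_product continuous_intros continuous_on_product_coordinates)
    ultimately show ?thesis by blast
  qed
  obtain A0 where A0: "continuous_on UNIV A0" "A0 ` cube = U0" using stretch assms by metis
  obtain A1 where A1: "continuous_on UNIV A1" "A1 ` cube = U1" using stretch assms by metis
  define s where "s t = max 0 (min 1 ((t + 1) / 2))" for t :: real
  define F where "F t i = (1 - s t) * A0 (\<gamma> \<bar>t\<bar>) i + s t * A1 (\<gamma> \<bar>t\<bar>) i" for t i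
  have F0: "F t = A0 (\<gamma> \<bar>t\<bar>)" if "t \<le> -1" for t using that by (auto simp: F_def s_def)
  have F1: "F t = A1 (\<gamma> \<bar>t\<bar>)" if "1 \<le> t" for t using that by (auto simp: F_def s_def)
  have hit: "\<exists>t. max T 1 \<le> t \<and> A (\<gamma> t) \<in> V"
    if "u \<in> A ` cube" "continuous_on UNIV A" "open V" "u \<in> V" for A u V T
  proof -
    obtain c where "c \<in> cube" "u = A c" using \<open>u \<in> A ` cube\<close> by blast
    then show ?thesis
      using \<gamma>_dense[of c "A -` V" "max T 1"] open_vimage[OF that(3,2)] \<open>u \<in> V\<close> by auto
  qed
  show ?thesis
  proof (intro exI[of _ F] conjI allI ballI impI)
    have c: "continuous_on UNIV (\<lambda>t. A (\<gamma> \<bar>t\<bar>) i)" if "continuous_on UNIV A"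
      for A :: "(nat \<Rightarrow> real) \<Rightarrow> nat \<Rightarrow> real" and i
    proof (rule continuous_on_compose2[OF continuous_on_product_then_coordinatewise[OF that]])
      show "continuous_on UNIV (\<lambda>t. \<gamma> \<bar>t\<bar>)"
        by (rule continuous_on_compose2[OF \<gamma>(1)]) (auto intro: continuous_intros)
    qed auto
    have "continuous_on UNIV s"
      unfolding s_def by (intro continuous_intros) auto
    then have "continuous_on UNIV (\<lambda>t. F t i)" for i
      unfolding F_def
      by (intro continuous_on_add continuous_on_mult continuous_on_diff continuous_on_const
          c[OF A0(1)] c[OF A1(1)])
    then show "continuous_on UNIV F" by (rule continuous_on_coordinatewise_then_product)
    show "F t \<in> cube" for t
    proof -
      have "A0 (\<gamma> \<bar>t\<bar>) \<in> cube" "A1 (\<gamma> \<bar>t\<bar>) \<in> cube"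
        using A0 A1 \<gamma>(2) bricks_subset_cube assms by blast+
      then have a: "0 \<le> A0 (\<gamma> \<bar>t\<bar>) i" "A0 (\<gamma> \<bar>t\<bar>) i \<le> 1" "0 \<le> A1 (\<gamma> \<bar>t\<bar>) i" "A1 (\<gamma> \<bar>t\<bar>) i \<le> 1" for i
        by (auto simp: cube_def)
      have st: "0 \<le> s t" "s t \<le> 1" by (auto simp: s_def)
      have "0 \<le> F t i \<and> F t i \<le> 1" for i
      proof
        show "0 \<le> F t i" unfolding F_def using a st by (intro add_nonneg_nonneg mult_nonneg_nonneg) auto
        have "F t i \<le> (1 - s t) * 1 + s t * 1"
          unfolding F_def using a st by (intro add_mono mult_left_mono) auto
        then show "F t i \<le> 1" by simp
      qed
      then show ?thesis by (simp add: cube_def)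
    qed
    show "F t \<in> U0" if "t \<le> -1" for t using F0[OF that] A0(2) \<gamma>(2) by blast
    show "F t \<in> U1" if "1 \<le> t" for t using F1[OF that] A1(2) \<gamma>(2) by blast
    show "\<exists>t. T \<le> - t \<and> F t \<in> V" if "u \<in> U0" "open V" "u \<in> V" for u V T
    proof -
      obtain t where t: "max T 1 \<le> t" "A0 (\<gamma> t) \<in> V" 
        using hit[OF _ A0(1) \<open>open V\<close> \<open>u \<in> V\<close>, of T] A0(2) \<open>u \<in> U0\<close> by blast
      then have "F (- t) \<in> V" using F0[of "- t"] by simp
      then show ?thesis using t by (intro exI[of _ "- t"]) simp
    qed
    show "\<exists>t. T \<le> t \<and> F t \<in> V" if "u \<in> U1" "open V" "u \<in> V" for u V T
    proof -
      obtain t where t: "max T 1 \<le> t" "A1 (\<gamma> t) \<in> V" 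
        using hit[OF _ A1(1) \<open>open V\<close> \<open>u \<in> V\<close>, of T] A1(2) \<open>u \<in> U1\<close> by blast
      then have "F t \<in> V" using F1[of t] by simp
      then show ?thesis using t by (intro exI[of _ t]) simp
    qed
  qed
qed

lemma chained_cube_exists:
  assumes "countable P" "P \<noteq> {}" "P \<subseteq> bricks \<times> bricks"
  obtains F E where "chained_cube F E" "range (\<lambda>n. (E n (-1), E n 1)) = P"
proof -
  define p where "p = from_nat_into P"
  have p: "fst (p n) \<in> bricks" "snd (p n) \<in> bricks" for n
    using from_nat_into[OF assms(2), of n] assms(3) by (auto simp: p_def)
  define Q where "Q n F \<longleftrightarrow> continuous_on UNIV F \<and> (\<forall>t. F t \<in> cube) \<and> (\<forall>t\<le>-1. F t \<in> fst (p n)) \<and> (\<forall>t\<ge>1. F t \<in> snd (p n))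
    \<and> (\<forall>u\<in>fst (p n). \<forall>V T. open V \<longrightarrow> u \<in> V \<longrightarrow> (\<exists>t. T \<le> - t \<and> F t \<in> V))
    \<and> (\<forall>u\<in>snd (p n). \<forall>V T. open V \<longrightarrow> u \<in> V \<longrightarrow> (\<exists>t. T \<le> t \<and> F t \<in> V))" for n and F :: "real \<Rightarrow> nat \<Rightarrow> real"
  have "\<exists>F. Q n F" for n unfolding Q_def by (rule path_between_bricks[OF p])
  then obtain F where "\<And>n. Q n (F n)" by metis
  note F = this[unfolded Q_def]
  define E where "E n \<sigma> = (if \<sigma> = (1::int) then snd (p n) else fst (p n))" for n \<sigma>
  show thesis
  proof
    show "chained_cube F E"
    proof
      fix n t \<sigma> u V and T :: real
      show "continuous_on UNIV (F n)" "F n t \<in> cube" using F[of n] by simp_all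
      assume \<sigma>: "\<sigma> \<in> {-1, 1::int}"
      show "closed (E n \<sigma>)" using p[of n] bricks_closed by (simp add: E_def)
      show "F n t \<in> E n \<sigma>" if "1 \<le> of_int \<sigma> * t"
        using \<sigma> that F[of n] by (elim insertE) (simp_all add: E_def)
      show "\<exists>t. T \<le> of_int \<sigma> * t \<and> F n t \<in> V" if "u \<in> E n \<sigma>" "open V" "u \<in> V"
        using \<sigma> that F[of n] by (elim insertE) (simp_all add: E_def)
    qed
    show "range (\<lambda>n. (E n (-1), E n 1)) = P"
      using range_from_nat_into[OF assms(2,1)] by (simp add: E_def p_def)
  qed
qed

section \<open>Polish spaces as complements of countably many bricks\<close>

definition separating_pairs :: "((nat \<Rightarrow> real) set \<times> (nat \<Rightarrow> real) set) set" where
  "separating_pairs = (\<lambda>(i, p, q). (brick (\<lambda>_. 0) ((\<lambda>_. 1)(i := of_rat p)), brick ((\<lambda>_. 0)(i := of_rat q)) (\<lambda>_. 1)))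
     ` {(i::nat, p::rat, q::rat). 0 < p \<and> p < q \<and> q < 1}"

lemma countable_separating_pairs: "countable separating_pairs"
  unfolding separating_pairs_def by (intro countable_image countableI_type)

lemma separating_pairs_bricks: "separating_pairs \<subseteq> bricks \<times> bricks"
  unfolding separating_pairs_def by (auto intro!: bricksI)

lemma separating_pairs_disjoint: "(U, V) \<in> separating_pairs \<Longrightarrow> U \<inter> V = {}"
  unfolding separating_pairs_def brick_def
  by (auto simp: disjoint_iff) (smt (verit) fun_upd_same of_rat_less)

lemma separating_pairs_separate:
  assumes "x \<in> cube" "y \<in> cube" "x i < y i"
  shows "\<exists>(U, V) \<in> separating_pairs. x \<in> U \<and> y \<in> V"
proof -
  obtain p where p: "x i < of_rat p" "of_rat p < y i" using of_rat_dense[OF assms(3)] by blast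
  obtain q where q: "(of_rat p :: real) < of_rat q" "of_rat q < y i" using of_rat_dense[OF p(2)] by blast
  have "0 \<le> x i" "y i \<le> 1" using assms by (auto simp: cube_def)
  then have "(0::real) < of_rat p" "of_rat q < (1::real)" using p q by linarith+
  then have "0 < p" "p < q" "q < 1" using q by (auto simp: of_rat_less)
  then show ?thesis
    using assms p q unfolding separating_pairs_def
    by (intro bexI[OF _ imageI[of "(i, p, q)"]]) (auto simp: brick_def cube_def)
qed

text \<open>
  The vectors whose entries stay away from \<open>0\<close>: they would be the distances from a dense sequence of
  a point outside the space.
\<close>

definition far_bricks :: "(nat \<Rightarrow> real) set set" where
  "far_bricks = range (\<lambda>m. brick (\<lambda>_. 1 / (real m + 1)) (\<lambda>_. 1))"

text \<open>
  For distances \<open>\<rho>\<close> bounded by \<open>1\<close>, these bricks cover exactly the vectors \<open>y\<close> of the cube that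
  violate \<open>y j - y k \<le> \<rho> j k\<close> or \<open>\<rho> j k \<le> y j + y k\<close>. Each violation is strict, so rational bounds \<open>p\<close> and \<open>q\<close> for \<open>y j\<close> and \<open>y k\<close> witness it. For \<open>j = k\<close> the first kind
  would give empty sets, which are not bricks.
\<close>

definition triangle_bricks :: "(nat \<Rightarrow> nat \<Rightarrow> real) \<Rightarrow> (nat \<Rightarrow> real) set set" where
  "triangle_bricks \<rho> =
     (\<lambda>(j, k, p, q). brick ((\<lambda>_. 0)(j := of_rat p)) ((\<lambda>_. 1)(k := of_rat q)))
       ` {(j, k, p::rat, q::rat). j \<noteq> k \<and> 0 \<le> p \<and> p \<le> 1 \<and> 0 \<le> q \<and> q \<le> 1 \<and> \<rho> j k < of_rat p - of_rat q}
   \<union> (\<lambda>(j, k, p, q). brick (\<lambda>_. 0) ((\<lambda>_. 1)(j := of_rat p, k := of_rat q)))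
       ` {(j, k, p::rat, q::rat). j \<noteq> k \<and> 0 \<le> p \<and> p \<le> 1 \<and> 0 \<le> q \<and> q \<le> 1 \<and> of_rat p + of_rat q < \<rho> j k}"

lemma countable_far_bricks: "countable far_bricks"
  by (simp add: far_bricks_def)

lemma countable_triangle_bricks: "countable (triangle_bricks \<rho>)"
  unfolding triangle_bricks_def by (intro countable_Un countable_image countableI_type)

lemma far_bricks_bricks: "far_bricks \<subseteq> bricks"
  by (auto simp: far_bricks_def intro!: bricksI)

lemma triangle_bricks_bricks: "triangle_bricks \<rho> \<subseteq> bricks"
  unfolding triangle_bricks_def by (auto intro!: bricksI)

lemma notin_far_bricks:
  assumes "y \<in> cube"
  shows "y \<notin> \<Union> far_bricks \<longleftrightarrow> (\<forall>m. \<exists>n. y n < 1 / (real m + 1))"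
  using assms by (auto simp: far_bricks_def brick_def cube_def not_le)

lemma notin_triangle_bricks:
  assumes y: "y \<in> cube" and \<rho>: "\<And>j k. 0 \<le> \<rho> j k" "\<And>j k. \<rho> j k \<le> 1" "\<And>j. \<rho> j j = 0"
  shows "y \<notin> \<Union> (triangle_bricks \<rho>) \<longleftrightarrow> (\<forall>j k. y j - y k \<le> \<rho> j k \<and> \<rho> j k \<le> y j + y k)"
proof
  have y01: "0 \<le> y i" "y i \<le> 1" for i using y by (auto simp: cube_def)
  show "\<forall>j k. y j - y k \<le> \<rho> j k \<and> \<rho> j k \<le> y j + y k" if no: "y \<notin> \<Union> (triangle_bricks \<rho>)"
  proof (intro allI conjI)
    fix j k
    show "y j - y k \<le> \<rho> j k"
    proof (rule ccontr)
      assume "\<not> ?thesis"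
      then have less: "\<rho> j k < y j - y k" by simp
      then have jk: "j \<noteq> k" using \<rho>(3) by auto
      define \<delta> where "\<delta> = y j - y k - \<rho> j k"
      have \<delta>: "0 < \<delta>" "\<delta> \<le> y j" "y k + \<delta> \<le> y j" using less y01[of k] \<rho>(1)[of j k] by (auto simp: \<delta>_def)
      obtain p where p: "y j - \<delta> / 2 < of_rat p" "of_rat p < y j"
        using of_rat_dense[of "y j - \<delta> / 2" "y j"] \<delta> by auto
      obtain q where q: "y k < of_rat q" "of_rat q < y k + \<delta> / 2"
        using of_rat_dense[of "y k" "y k + \<delta> / 2"] \<delta> by auto
      have "0 \<le> (of_rat p :: real)" "of_rat p \<le> (1::real)" "0 \<le> (of_rat q :: real)" "of_rat q \<le> (1::real)"
        using p q \<delta> y01[of j] y01[of k] by linarith+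
      then have pq: "0 \<le> p" "p \<le> 1" "0 \<le> q" "q \<le> 1" by simp_all
      have "\<rho> j k < of_rat p - of_rat q" using p q unfolding \<delta>_def by argo
      then have "brick ((\<lambda>_. 0)(j := of_rat p)) ((\<lambda>_. 1)(k := of_rat q)) \<in> triangle_bricks \<rho>"
        unfolding triangle_bricks_def using pq jk by (intro UnI1 image_eqI[of _ _ "(j, k, p, q)"]) auto
      moreover have "y \<in> brick ((\<lambda>_. 0)(j := of_rat p)) ((\<lambda>_. 1)(k := of_rat q))"
        using y01 p q by (auto simp: brick_def)
      ultimately show False using no by blast
    qed
    show "\<rho> j k \<le> y j + y k"
    proof (rule ccontr)
      assume "\<not> ?thesis"
      then have less: "y j + y k < \<rho> j k" by simp
      then have jk: "j \<noteq> k" using \<rho>(3)[of j] y01[of j] y01[of k] by (cases "j = k") auto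
      define \<delta> where "\<delta> = \<rho> j k - y j - y k"
      have \<delta>: "0 < \<delta>" "y j + \<delta> \<le> 1" "y k + \<delta> \<le> 1"
        using less y01[of k] y01[of j] \<rho>(2)[of j k] by (auto simp: \<delta>_def)
      obtain p where p: "y j < of_rat p" "of_rat p < y j + \<delta> / 2"
        using of_rat_dense[of "y j" "y j + \<delta> / 2"] \<delta> by auto
      obtain q where q: "y k < of_rat q" "of_rat q < y k + \<delta> / 2"
        using of_rat_dense[of "y k" "y k + \<delta> / 2"] \<delta> by auto
      have "0 \<le> (of_rat p :: real)" "of_rat p \<le> (1::real)" "0 \<le> (of_rat q :: real)" "of_rat q \<le> (1::real)"
        using p q \<delta> y01[of j] y01[of k] by linarith+
      then have pq: "0 \<le> p" "p \<le> 1" "0 \<le> q" "q \<le> 1" by simp_all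
      have "of_rat p + of_rat q < \<rho> j k" using p q unfolding \<delta>_def by argo
      then have "brick (\<lambda>_. 0) ((\<lambda>_. 1)(j := of_rat p, k := of_rat q)) \<in> triangle_bricks \<rho>"
        unfolding triangle_bricks_def using pq jk by (intro UnI2 image_eqI[of _ _ "(j, k, p, q)"]) auto
      moreover have "y \<in> brick (\<lambda>_. 0) ((\<lambda>_. 1)(j := of_rat p, k := of_rat q))"
        using y01 p q by (auto simp: brick_def)
      ultimately show False using no by blast
    qed
  qed
  show "y \<notin> \<Union> (triangle_bricks \<rho>)" if *: "\<forall>j k. y j - y k \<le> \<rho> j k \<and> \<rho> j k \<le> y j + y k"
  proof
    assume "y \<in> \<Union> (triangle_bricks \<rho>)"
    then consider j k and p q :: rat where "j \<noteq> k" "\<rho> j k < of_rat p - of_rat q"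
        "y \<in> brick ((\<lambda>_. 0)(j := of_rat p)) ((\<lambda>_. 1)(k := of_rat q))"
      | j k and p q :: rat where "j \<noteq> k" "of_rat p + of_rat q < \<rho> j k"
        "y \<in> brick (\<lambda>_. 0) ((\<lambda>_. 1)(j := of_rat p, k := of_rat q))"
      unfolding triangle_bricks_def by (auto simp: Bex_def)
    then show False
    proof cases
      case 1
      then have "of_rat p \<le> y j" "y k \<le> of_rat q"
        unfolding brick_def mem_Collect_eq by (metis fun_upd_same)+
      then show ?thesis using 1 *[rule_format, of j k] by linarith
    next
      case 2
      then have "y j \<le> of_rat p" "y k \<le> of_rat q"
        unfolding brick_def mem_Collect_eq by (metis fun_upd_same fun_upd_other)+
      then show ?thesis using 2 *[rule_format, of j k] by linarith
    qed
  qed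
qed

context Metric_space
begin

text \<open>
  Let \<open>y\<close> belong to none of the bricks. If \<open>y j\<close> and \<open>y k\<close> are small, then so is
  \<open>d (c j) (c k) \<le> y j + y k\<close>. Indices along which \<open>y\<close> tends to \<open>0\<close> therefore give a Cauchy sequence,
  and the triangle inequalities identify \<open>y\<close> with the distances from its limit.
\<close>

lemma distance_vectors_eq:
  assumes complete: mcomplete and bound: "\<And>x y. d x y \<le> 1"
    and c: "\<And>n. c n \<in> M" and dense: "\<And>x e. x \<in> M \<Longrightarrow> 0 < e \<Longrightarrow> \<exists>n. d x (c n) < e"
  shows "(\<lambda>x n. d x (c n)) ` M = cube - \<Union> (far_bricks \<union> triangle_bricks (\<lambda>j k. d (c j) (c k)))"
proof (intro equalityI subsetI)
  note tri = notin_triangle_bricks[of _ "\<lambda>j k. d (c j) (c k)", OF _ nonneg bound mdist_zero[OF c]]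
  fix y assume "y \<in> (\<lambda>x n. d x (c n)) ` M"
  then obtain x where x: "x \<in> M" "y = (\<lambda>n. d x (c n))" by blast
  have y: "y \<in> cube" using bound by (simp add: x cube_def)
  moreover have "y \<notin> \<Union> far_bricks"
    unfolding notin_far_bricks[OF y] using dense[OF x(1)] by (simp add: x)
  moreover have "y \<notin> \<Union> (triangle_bricks (\<lambda>j k. d (c j) (c k)))"
    unfolding tri[OF y]
  proof (intro allI conjI)
    fix j k
    show "y j - y k \<le> d (c j) (c k)"
      using triangle[OF x(1) c c, of j k] by (simp add: x commute)
    show "d (c j) (c k) \<le> y j + y k"
      using triangle[OF c x(1) c, of j k] by (simp add: x commute)
  qed
  ultimately show "y \<in> cube - \<Union> (far_bricks \<union> triangle_bricks (\<lambda>j k. d (c j) (c k)))" by blast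
next
  note tri = notin_triangle_bricks[of _ "\<lambda>j k. d (c j) (c k)", OF _ nonneg bound mdist_zero[OF c]]
  fix y assume *: "y \<in> cube - \<Union> (far_bricks \<union> triangle_bricks (\<lambda>j k. d (c j) (c k)))"
  then have y: "y \<in> cube" by blast
  have "\<forall>m. \<exists>n. y n < 1 / (real m + 1)" using * notin_far_bricks[OF y] by blast
  then obtain \<nu> where \<nu>: "\<And>m. y (\<nu> m) < 1 / (real m + 1)" by metis
  have yd: "y j - y k \<le> d (c j) (c k)" "d (c j) (c k) \<le> y j + y k" for j k
    using * tri[OF y] by blast+
  have small: "\<exists>N. \<forall>m\<ge>N. y (\<nu> m) < e" if "0 < e" for e
  proof -
    obtain N where N: "1 / (real N + 1) < e"
      using reals_Archimedean[OF \<open>0 < e\<close>] by (auto simp: inverse_eq_divide add.commute)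
    have "y (\<nu> m) < e" if "m \<ge> N" for m
    proof -
      have "1 / (real m + 1) \<le> 1 / (real N + 1)" using that by (intro divide_left_mono) auto
      then show ?thesis using \<nu>[of m] N by linarith
    qed
    then show ?thesis by blast
  qed
  have "MCauchy (\<lambda>m. c (\<nu> m))"
    unfolding MCauchy_def
  proof (intro conjI allI impI)
    fix e :: real assume "0 < e"
    then obtain N where N: "\<And>m. m \<ge> N \<Longrightarrow> y (\<nu> m) < e / 2" using small[of "e / 2"] by auto
    have "d (c (\<nu> m)) (c (\<nu> m')) < e" if "N \<le> m" "N \<le> m'" for m m'
      using N[OF that(1)] N[OF that(2)] yd(2)[of "\<nu> m" "\<nu> m'"] by linarith
    then show "\<exists>N. \<forall>m m'. N \<le> m \<longrightarrow> N \<le> m' \<longrightarrow> d (c (\<nu> m)) (c (\<nu> m')) < e" by blast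
  qed (use c in auto)
  then obtain x where x: "limitin mtopology (\<lambda>m. c (\<nu> m)) x sequentially"
    using complete unfolding mcomplete_def by blast
  then have xM: "x \<in> M" using limitin_mspace by blast
  have "y k = d x (c k)" for k
  proof -
    have "\<bar>y k - d x (c k)\<bar> \<le> 0 + e" if "0 < e" for e
    proof -
      obtain N1 where N1: "\<And>m. m \<ge> N1 \<Longrightarrow> y (\<nu> m) < e / 2" using small[of "e / 2"] \<open>0 < e\<close> by auto
      obtain N2 where N2: "\<And>m. m \<ge> N2 \<Longrightarrow> d (c (\<nu> m)) x < e / 2"
        using x \<open>0 < e\<close> unfolding limitin_metric eventually_sequentially by (metis half_gt_zero)
      define m where "m = max N1 N2"
      have "y (\<nu> m) < e / 2" "d (c (\<nu> m)) x < e / 2" using N1 N2 by (simp_all add: m_def)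
      moreover have "\<bar>y k - d (c (\<nu> m)) (c k)\<bar> \<le> y (\<nu> m)"
        using yd(1)[of k "\<nu> m"] yd(2)[of "\<nu> m" k] commute[of "c k" "c (\<nu> m)"] by linarith
      moreover have "\<bar>d (c (\<nu> m)) (c k) - d x (c k)\<bar> \<le> d (c (\<nu> m)) x"
        using triangle[OF c xM c, of "\<nu> m" k] triangle[OF xM c c, of k "\<nu> m"] commute[of x "c (\<nu> m)"]
        by linarith
      ultimately show ?thesis by linarith
    qed
    then have "\<bar>y k - d x (c k)\<bar> \<le> 0" by (rule field_le_epsilon)
    then show ?thesis by simp
  qed
  then show "y \<in> (\<lambda>x n. d x (c n)) ` M" using xM by blast
qed

text \<open>
  If \<open>c n\<close> is close to \<open>x\<close>, the single coordinate \<open>n\<close> already forces each point with a similar vector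
  of distances to be close to \<open>x\<close>; this gives the continuity of the inverse.
\<close>

lemma distance_vectors_homeomorphic:
  fixes c :: "nat \<Rightarrow> 'a"
  assumes c: "\<And>n. c n \<in> M" and dense: "\<And>x e. x \<in> M \<Longrightarrow> 0 < e \<Longrightarrow> \<exists>n. d x (c n) < e"
  shows "top_of_set ((\<lambda>x n. d x (c n)) ` M) homeomorphic_space mtopology"
proof -
  let ?e = "\<lambda>x n. d x (c n)"
  have inj: "inj_on ?e M"
  proof (rule inj_onI)
    fix x y assume x: "x \<in> M" and y: "y \<in> M" and "?e x = ?e y"
    then have eq: "d x (c n) = d y (c n)" for n by meson
    have "d x y \<le> 0 + e" if "0 < e" for e
    proof -
      obtain n where "d x (c n) < e / 2" using dense[OF x, of "e / 2"] \<open>0 < e\<close> by auto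
      then show ?thesis using eq[of n] triangle[OF x c y, of n] commute[of y "c n"] by simp
    qed
    then have "d x y \<le> 0" by (rule field_le_epsilon)
    then show "x = y" using x y nonneg[of x y] zero by simp
  qed
  define g where "g = the_inv_into M ?e"
  have g: "g (?e x) = x" if "x \<in> M" for x
    unfolding g_def by (rule the_inv_into_f_f[OF inj that])
  have "continuous_map mtopology euclideanreal (\<lambda>x. d x (c n))" for n
  proof -
    have "continuous_map mtopology Met_TC.mtopology (\<lambda>x. d x (c n))"
      unfolding Met_TC.continuous_map_to_metric
    proof (intro ballI allI impI)
      fix x and e :: real assume "x \<in> topspace mtopology" "0 < e"
      then have x: "x \<in> M" by simp
      show "\<exists>U. openin mtopology U \<and> x \<in> U \<and> (\<forall>y\<in>U. d y (c n) \<in> Met_TC.mball (d x (c n)) e)"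
      proof (intro exI conjI ballI)
        show "openin mtopology (mball x e)" by simp
        show "x \<in> mball x e" using x \<open>0 < e\<close> by simp
        fix y assume "y \<in> mball x e"
        then have y: "y \<in> M" "d x y < e" by auto
        have "\<bar>d x (c n) - d y (c n)\<bar> < e"
          using y(2) triangle[OF x y(1) c, of n] triangle[OF y(1) x c, of n] commute[of x y] by linarith
        then show "d y (c n) \<in> Met_TC.mball (d x (c n)) e" by (simp add: dist_real_def)
      qed
    qed
    then show ?thesis by simp
  qed
  then have 1: "continuous_map mtopology (top_of_set (?e ` M)) ?e"
    unfolding continuous_map_in_subtopology euclidean_product_topology[symmetric]
      continuous_map_componentwise_UNIV by auto
  have 2: "continuous_map (top_of_set (?e ` M)) mtopology g"
    unfolding continuous_map_to_metric
  proof (intro ballI allI impI)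
    fix y and \<epsilon> :: real assume "y \<in> topspace (top_of_set (?e ` M))" "0 < \<epsilon>"
    then obtain x where x: "x \<in> M" "y = ?e x" by auto
    obtain n where n: "d x (c n) < \<epsilon> / 2" using dense[OF x(1), of "\<epsilon> / 2"] \<open>0 < \<epsilon>\<close> by auto
    let ?U = "?e ` M \<inter> {z. z n < \<epsilon> / 2}"
    show "\<exists>U. openin (top_of_set (?e ` M)) U \<and> y \<in> U \<and> (\<forall>z\<in>U. g z \<in> mball (g y) \<epsilon>)"
    proof (intro exI[of _ ?U] conjI ballI)
      have "open {z::nat \<Rightarrow> real. z n < \<epsilon> / 2}"
        by (intro open_Collect_less continuous_on_product_coordinates continuous_on_const)
      then show "openin (top_of_set (?e ` M)) ?U" by (rule openin_open_Int)
      show "y \<in> ?U" using x n by simp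
      fix z assume "z \<in> ?U"
      then obtain x' where x': "x' \<in> M" "z = ?e x'" "d x' (c n) < \<epsilon> / 2" by auto
      have "d x x' < \<epsilon>" using n x'(3) triangle[OF x(1) c x'(1), of n] commute[of x' "c n"] by linarith
      then show "g z \<in> mball (g y) \<epsilon>" using x x' g by simp
    qed
  qed
  have "homeomorphic_maps (top_of_set (?e ` M)) mtopology g ?e"
    unfolding homeomorphic_maps_def using 1 2 g by auto
  then show ?thesis by (auto simp: homeomorphic_space_def)
qed

end

lemma polish_space_brick_complement:
  assumes "completely_metrizable_space Z" "separable_space Z"
  obtains \<G> where "countable \<G>" "\<G> \<subseteq> bricks" "top_of_set (cube - \<Union>\<G>) homeomorphic_space Z"
proof (cases "topspace Z = {}")
  case True
  then have "top_of_set (cube - \<Union>{cube}) homeomorphic_space Z"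
    by (simp add: homeomorphic_empty_space_eq)
  then show thesis using that[of "{cube}"] cube_in_bricks by simp
next
  case False
  obtain M d where Md: "Metric_space M d" "Metric_space.mcomplete M d" "Z = Metric_space.mtopology M d"
    using assms(1) unfolding completely_metrizable_space_def by blast
  define d' where "d' = Metric_space.capped_dist d 1"
  interpret D: Metric_space M d using Md(1) .
  interpret D': Metric_space M d' unfolding d'_def by (rule D.capped_dist)
  have Z: "D'.mtopology = Z" unfolding Md(3) d'_def by (rule D.mtopology_capped_metric)
  have comp: "D'.mcomplete" unfolding d'_def using D.mcomplete_capped_metric Md(2) by blast
  have bound: "d' x y \<le> 1" for x y by (simp add: d'_def D.capped_dist_def)
  obtain C where C: "countable C" "C \<subseteq> M" "D'.mtopology closure_of C = M"
    using assms(2) unfolding separable_space_def Z[symmetric] by auto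
  have "C \<noteq> {}" using C(3) False by (auto simp: Z[symmetric])
  define c where "c = from_nat_into C"
  have c: "c n \<in> M" for n using from_nat_into[OF \<open>C \<noteq> {}\<close>] C(2) by (auto simp: c_def)
  have dense: "\<exists>n. d' x (c n) < e" if "x \<in> M" "0 < e" for x e
  proof -
    have "x \<in> D'.mtopology closure_of C" using C(3) that by simp
    then obtain y where "y \<in> C" "y \<in> D'.mball x e"
      using \<open>0 < e\<close> unfolding D'.metric_closure_of by blast
    moreover obtain n where "c n = y" using from_nat_into_surj[OF C(1)] \<open>y \<in> C\<close> by (auto simp: c_def)
    ultimately show ?thesis by auto
  qed
  let ?G = "far_bricks \<union> triangle_bricks (\<lambda>j k. d' (c j) (c k))"
  have "(\<lambda>x n. d' x (c n)) ` M = cube - \<Union>?G"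
    by (rule D'.distance_vectors_eq[OF comp bound c dense])
  moreover have "top_of_set ((\<lambda>x n. d' x (c n)) ` M) homeomorphic_space D'.mtopology"
    by (rule D'.distance_vectors_homeomorphic[OF c dense])
  ultimately have "top_of_set (cube - \<Union>?G) homeomorphic_space Z"
    unfolding Z by simp
  moreover have "countable ?G" "?G \<subseteq> bricks"
    using countable_far_bricks countable_triangle_bricks far_bricks_bricks triangle_bricks_bricks by auto
  ultimately show thesis by (rule that[rotated 2])
qed

section \<open>Polish spaces as spaces of nonblocking sets\<close>

theorem theorem1p1:
  fixes Z :: "'z topology"
  assumes "completely_metrizable_space Z" and "separable_space Z"
  shows "\<exists>X :: (nat \<Rightarrow> real) metric. continuum X \<and> NB_F1_topology X homeomorphic_space Z"
proof -
  obtain \<G> where \<G>: "countable \<G>" "\<G> \<subseteq> bricks" "top_of_set (cube - \<Union>\<G>) homeomorphic_space Z"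
    using polish_space_brick_complement[OF assms] .
  define P where "P = separating_pairs \<union> (\<lambda>G. (G, G)) ` \<G>"
  have P: "countable P" unfolding P_def using \<G>(1) countable_separating_pairs by blast
  have P_bricks: "P \<subseteq> bricks \<times> bricks" unfolding P_def using \<G>(2) separating_pairs_bricks by blast
  have P_ne: "P \<noteq> {}"
    using separating_pairs_separate[of "\<lambda>_. 0" "\<lambda>_. 1" 0] by (auto simp: P_def cube_def)
  obtain F E where FE: "chained_cube F E" "range (\<lambda>n. (E n (-1), E n 1)) = P"
    by (rule chained_cube_exists[OF P P_ne P_bricks])
  interpret chained_cube F E by (fact FE(1))
  have mem: "(U, V) \<in> P \<longleftrightarrow> (\<exists>n. U = E n (-1) \<and> V = E n 1)" for U V
    unfolding FE(2)[symmetric] by auto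
  have "\<exists>n. u \<in> E n (-1) \<and> v \<in> E n 1 \<or> v \<in> E n (-1) \<and> u \<in> E n 1"
    if "u \<in> cube" "v \<in> cube" "u \<noteq> v" for u v
  proof -
    have sep: "\<exists>n. u \<in> E n (-1) \<and> v \<in> E n 1" if "u \<in> cube" "v \<in> cube" "u i < v i" for u v i
      using separating_pairs_separate[OF that] mem unfolding P_def by blast
    obtain i where "u i < v i \<or> v i < u i" using \<open>u \<noteq> v\<close> by (meson ext linorder_neqE)
    then show ?thesis using sep[of u v i] sep[of v u i] \<open>u \<in> cube\<close> \<open>v \<in> cube\<close> by blast
  qed
  then have "NB_F1_topology (submetric_space X) homeomorphic_space
      top_of_set (cube - (\<Union>n. E n (-1) \<inter> E n 1))"
    by (rule NB_F1_topology_X)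
  also have "(\<Union>n. E n (-1) \<inter> E n 1) = \<Union>\<G>"
  proof -
    have "(\<Union>n. E n (-1) \<inter> E n 1) = (\<Union>(U, V)\<in>P. U \<inter> V)"
      unfolding FE(2)[symmetric] by auto
    also have "\<dots> = \<Union>\<G>"
      using separating_pairs_disjoint by (auto simp: P_def)
    finally show ?thesis .
  qed
  also note \<G>(3)
  finally show ?thesis using continuum_X by blast
qed

end
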